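(* There is a morphism of Hopf algebras $\theta:\mathcal{S}\to QSym$ from the shuffle algebra to the algebra of quasisymmetric functions such that, if $w$ is a word with distinct letters, then $\theta(w)=F_{\mathrm{Des}(w)}$.
   Context: The shuffle algebra $\mathcal{S}$ (over $\mathbb{R}$) has as basis all words in the letters $\{1,2,\dots\}$, graded by length; the product of two words is the sum of all their interleavings with multiplicity, and the coproduct is deconcatenation, $\Delta(w_1\cdots w_n)=\sum_{i=0}^nw_1\cdots w_i\otimes w_{i+1}\cdots w_n$. A composition is a list $I=(i_1,\dots,i_{l(I)})$ of positive integers, $|I|=i_1+\dots+i_{l(I)}$. $J\ge I$ means that $J$ refines $I$ (i.e. $I$ is obtained from $J$ by gluing together some adjacent parts). $QSym$ is the subalgebra of the algebra of power series in commuting variables $x_1,x_2,\dots$ spanned by the monomial quasisymmetric functions $M_I=\sum_{j_1<\dots<j_{l(I)}}x_{j_1}^{i_1}\cdots x_{j_{l(I)}}^{i_{l(I)}}$, graded by $\deg M_I=|I|$, with coproduct $\Delta(M_I)=\sum_{j=0}^{l(I)}M_{(i_1,\dots,i_j)}\otimes M_{(i_{j+1},\dots,i_{l(I)})}$. The fundamental quasisymmetric functions are $F_I=\sum_{J\ge I}M_J$. For a word $w=w_1\cdots w_n$, the descent composition $\mathrm{Des}(w)=(i_1,\dots,i_l)$ is the composition of $n$ such that $w_r>w_{r+1}$ exactly when $r=i_1+\dots+i_j$ for some $1\le j<l$ (and $w_r\le w_{r+1}$ for all other $r$). A morphism of Hopf algebras is a linear, unit- and degree-preserving map which respects products and coproducts.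 *)

theory Defs
  imports Complex_Main "HOL-Library.Poly_Mapping" "HOL-Library.Function_Algebras"
begin

section \<open>Real-valued functions as a vector space, and tensor products\<close>

text \<open>
  Every vector of this development is a family of real coefficients: indexed by words for the
  shuffle algebra, by monomials for formal power series.  Addition is the pointwise one; the
  pointwise multiplication of functions is never used as a product of the algebras below.
\<close>

instantiation "fun" :: (type, real_vector) real_vector
begin

definition scaleR_fun_def: "c *\<^sub>R f = (\<lambda>x. c *\<^sub>R f x)"

instance
  by standard (auto simp: scaleR_fun_def fun_eq_iff scaleR_add_right scaleR_add_left)

end

definition linear_on :: "'v::real_vector set \<Rightarrow> ('v \<Rightarrow> 'w::real_vector) \<Rightarrow> bool" where
  "linear_on V T \<longleftrightarrow>
     (\<forall>f\<in>V. \<forall>g\<in>V. T (f + g) = T f + T g) \<and> (\<forall>c. \<forall>f\<in>V. T (c *\<^sub>R f) = c *\<^sub>R T f)"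

text \<open>
  The algebraic tensor product of two spaces of functions on \<open>X\<close> and \<open>Y\<close> embeds into the functions
  on \<open>X \<times> Y\<close>; \<open>tensor_space V W\<close> is its image.
\<close>

definition tensor :: "('x \<Rightarrow> real) \<Rightarrow> ('y \<Rightarrow> real) \<Rightarrow> ('x \<times> 'y \<Rightarrow> real)" where
  "tensor f g = (\<lambda>(x, y). f x * g y)"

definition tensor_space ::
    "('x \<Rightarrow> real) set \<Rightarrow> ('y \<Rightarrow> real) set \<Rightarrow> ('x \<times> 'y \<Rightarrow> real) set" where
  "tensor_space V W = span {tensor f g | f g. f \<in> V \<and> g \<in> W}"


section \<open>Graded Hopf algebras and their morphisms\<close>

record 'x graded_hopf =
  hspace :: "('x \<Rightarrow> real) set"
  hdegree :: "nat \<Rightarrow> ('x \<Rightarrow> real) set"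
  hunit :: "'x \<Rightarrow> real"
  hmult :: "('x \<Rightarrow> real) \<Rightarrow> ('x \<Rightarrow> real) \<Rightarrow> ('x \<Rightarrow> real)"
  hcomult :: "('x \<Rightarrow> real) \<Rightarrow> ('x \<times> 'x \<Rightarrow> real)"

text \<open>
  In the last clause \<open>\<Theta>\<close> is \<open>\<theta> \<otimes> \<theta>\<close>: its values on pure tensors and linearity determine it on the
  whole tensor square, which contains all coproducts.
\<close>

definition hopf_morphism ::
    "'x graded_hopf \<Rightarrow> 'y graded_hopf \<Rightarrow> (('x \<Rightarrow> real) \<Rightarrow> ('y \<Rightarrow> real)) \<Rightarrow> bool" where
  "hopf_morphism A B \<theta> \<longleftrightarrow>
     (\<forall>f\<in>hspace A. \<theta> f \<in> hspace B) \<and>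
     linear_on (hspace A) \<theta> \<and>
     \<theta> (hunit A) = hunit B \<and>
     (\<forall>n. \<forall>f\<in>hdegree A n. \<theta> f \<in> hdegree B n) \<and>
     (\<forall>f\<in>hspace A. \<forall>g\<in>hspace A. \<theta> (hmult A f g) = hmult B (\<theta> f) (\<theta> g)) \<and>
     (\<exists>\<Theta>. linear_on (tensor_space (hspace A) (hspace A)) \<Theta> \<and>
          (\<forall>f\<in>hspace A. \<forall>g\<in>hspace A. \<Theta> (tensor f g) = tensor (\<theta> f) (\<theta> g)) \<and>
          (\<forall>f\<in>hspace A. hcomult B (\<theta> f) = \<Theta> (hcomult A f)))"


section \<open>The shuffle algebra\<close>

definition word :: "nat list \<Rightarrow> (nat list \<Rightarrow> real)" where
  "word w = (\<lambda>u. if u = w then 1 else 0)"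

definition is_word :: "nat list \<Rightarrow> bool" where
  "is_word w \<longleftrightarrow> (\<forall>a\<in>set w. a \<ge> 1)"

text \<open>
  The coefficient of \<open>w\<close> in a product runs over all ways of reading \<open>w\<close> as an interleaving: \<open>A\<close> is
  the set of positions occupied by the first factor.  Likewise the coefficient of \<open>u \<otimes> v\<close> in the
  deconcatenation of \<open>w\<close> is \<open>1\<close> iff \<open>w = u @ v\<close>.  See \<open>shuffle_mult_word\<close> and
  \<open>shuffle_comult_word\<close> below.
\<close>

definition shuffle_mult ::
    "(nat list \<Rightarrow> real) \<Rightarrow> (nat list \<Rightarrow> real) \<Rightarrow> (nat list \<Rightarrow> real)" where
  "shuffle_mult f g = (\<lambda>w. \<Sum>A\<in>Pow {..<length w}. f (nths w A) * g (nths w (- A)))"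

definition shuffle_comult :: "(nat list \<Rightarrow> real) \<Rightarrow> (nat list \<times> nat list \<Rightarrow> real)" where
  "shuffle_comult f = (\<lambda>(u, v). f (u @ v))"

definition shuffle_hopf :: "nat list graded_hopf" where
  "shuffle_hopf =
     \<lparr> hspace = span {word w | w. is_word w},
       hdegree = (\<lambda>n. span {word w | w. is_word w \<and> length w = n}),
       hunit = word [],
       hmult = shuffle_mult,
       hcomult = shuffle_comult \<rparr>"


section \<open>Quasisymmetric functions\<close>

definition composition :: "nat list \<Rightarrow> bool" where
  "composition I \<longleftrightarrow> (\<forall>i\<in>set I. i \<ge> 1)"

definition refines :: "nat list \<Rightarrow> nat list \<Rightarrow> bool" where
  "refines J I \<longleftrightarrow> (\<exists>Ks. (\<forall>K\<in>set Ks. K \<noteq> []) \<and> concat Ks = J \<and> map sum_list Ks = I)"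

text \<open>
  Monomials are finitely supported exponent families.  Variables are numbered from \<open>0\<close>: the index
  \<open>k\<close> stands for \<open>x\<^bsub>k+1\<^esub>\<close>.  A power series is the family of its coefficients.
\<close>

type_synonym monomial = "nat \<Rightarrow>\<^sub>0 nat"
type_synonym power_series = "monomial \<Rightarrow> real"

definition ps_one :: power_series where
  "ps_one = (\<lambda>m. if m = 0 then 1 else 0)"

definition ps_mult :: "power_series \<Rightarrow> power_series \<Rightarrow> power_series" where
  "ps_mult f g = (\<lambda>m. \<Sum>(a, b)\<in>{(a, b). a + b = m}. f a * g b)"

text \<open>\<open>mon js I\<close> is the product of the \<open>x\<^bsub>j\<^esub>\<close> to the power \<open>i\<close> over corresponding entries.\<close>

definition mon :: "nat list \<Rightarrow> nat list \<Rightarrow> monomial" where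
  "mon js I = sum_list (map2 Poly_Mapping.single js I)"

text \<open>The coefficient of \<open>m\<close> counts the summands equal to \<open>m\<close> in the defining infinite sum.\<close>

definition M_qsym :: "nat list \<Rightarrow> power_series" where
  "M_qsym I = (\<lambda>m. real (card {js. length js = length I \<and> sorted_wrt (<) js \<and> mon js I = m}))"

definition F_qsym :: "nat list \<Rightarrow> power_series" where
  "F_qsym I = (\<Sum>J\<in>{J. composition J \<and> refines J I}. M_qsym J)"

definition qsym :: "power_series set" where
  "qsym = span {M_qsym I | I. composition I}"

text \<open>
  The coefficient of \<open>M_qsym I\<close> in an element of \<open>qsym\<close> is that of the monomial with exponents \<open>I\<close> in
  the first \<open>length I\<close> variables.
\<close>

definition M_coeff :: "nat list \<Rightarrow> power_series \<Rightarrow> real" where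
  "M_coeff I f = f (mon [0..<length I] I)"

text \<open>
  The linear extension of the deconcatenation of compositions, see \<open>linear_on_qsym_comult\<close> and
  \<open>qsym_comult_M\<close> below.
\<close>

definition qsym_comult :: "power_series \<Rightarrow> (monomial \<times> monomial \<Rightarrow> real)" where
  "qsym_comult f =
     (\<Sum>I\<in>{I. composition I \<and> M_coeff I f \<noteq> 0}.
        M_coeff I f *\<^sub>R (\<Sum>j\<le>length I. tensor (M_qsym (take j I)) (M_qsym (drop j I))))"

definition qsym_hopf :: "monomial graded_hopf" where
  "qsym_hopf =
     \<lparr> hspace = qsym,
       hdegree = (\<lambda>n. span {M_qsym I | I. composition I \<and> sum_list I = n}),
       hunit = ps_one,
       hmult = ps_mult,
       hcomult = qsym_comult \<rparr>"


section \<open>Descent compositions\<close>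

text \<open>Positions in \<open>w\<close> are counted from \<open>0\<close> here, so \<open>w ! (r - 1)\<close> is the \<open>r\<close>-th letter.\<close>

definition is_descent_composition :: "nat list \<Rightarrow> nat list \<Rightarrow> bool" where
  "is_descent_composition w I \<longleftrightarrow>
     composition I \<and> sum_list I = length w \<and>
     (\<forall>r. 1 \<le> r \<and> r < length w \<longrightarrow>
        (w ! (r - 1) > w ! r \<longleftrightarrow> (\<exists>j. 1 \<le> j \<and> j < length I \<and> r = sum_list (take j I))))"

definition Des :: "nat list \<Rightarrow> nat list" where
  "Des w = (THE I. is_descent_composition w I)"


section \<open>The definitions agree with their descriptions on basis elements\<close>

lemma sum_fun_apply: "(\<Sum>a\<in>A. f a) x = (\<Sum>a\<in>A. f a x)" for f :: "'a \<Rightarrow> 'b \<Rightarrow> real"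
  by (induction A rule: infinite_finite_induct) auto

lemma sum_list_fun_apply: "sum_list (map f as) x = (\<Sum>a\<leftarrow>as. f a x)"
  for f :: "'a \<Rightarrow> 'b \<Rightarrow> real"
  by (induction as) auto

subsection \<open>Shuffle algebra\<close>

fun interleavings :: "'a list \<Rightarrow> 'a list \<Rightarrow> 'a list list" where
  "interleavings [] v = [v]"
| "interleavings (a # u) [] = [a # u]"
| "interleavings (a # u) (b # v) =
     map ((#) a) (interleavings u (b # v)) @ map ((#) b) (interleavings (a # u) v)"

lemma shuffle_mult_Nil: "shuffle_mult f g [] = f [] * g []"
  by (simp add: shuffle_mult_def)

lemma shuffle_mult_Cons:
  "shuffle_mult f g (c # w) =
     shuffle_mult (\<lambda>x. f (c # x)) g w + shuffle_mult f (\<lambda>x. g (c # x)) w"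
proof -
  have split: "Pow {..<Suc n} = (\<lambda>A. insert 0 (Suc ` A)) ` Pow {..<n} \<union> (`) Suc ` Pow {..<n}"
    (is "?L = ?R") for n
  proof
    show "?L \<subseteq> ?R"
    proof
      fix B assume B: "B \<in> ?L"
      let ?A = "{j. Suc j \<in> B}"
      have A: "?A \<in> Pow {..<n}" using B by auto
      have "B = insert 0 (Suc ` ?A) \<or> B = Suc ` ?A"
      proof (cases "0 \<in> B")
        case True
        have "x \<in> B \<longleftrightarrow> x \<in> insert 0 (Suc ` ?A)" for x
          using True by (cases x) auto
        then show ?thesis by blast
      next
        case False
        have "x \<in> B \<longleftrightarrow> x \<in> Suc ` ?A" for x
          using False by (cases x) auto
        then show ?thesis by blast
      qed
      then show "B \<in> ?R" using A by blast
    qed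
  qed auto
  have i1: "inj_on (\<lambda>A. insert 0 (Suc ` A)) (Pow {..<length w})"
  proof (rule inj_onI)
    fix A B :: "nat set"
    assume "insert 0 (Suc ` A) = insert 0 (Suc ` B)"
    then have "Suc ` A = Suc ` B" by (simp add: insert_ident)
    then show "A = B" by (simp add: inj_image_eq_iff)
  qed
  have i2: "inj_on ((`) Suc) (Pow {..<length w})"
    by (auto intro!: inj_onI simp: inj_image_eq_iff)
  have c: "{j. Suc j \<in> - insert 0 (Suc ` A)} = - A" "{j. Suc j \<in> - (Suc ` A)} = - A"
    "{j. Suc j \<in> insert 0 (Suc ` A)} = A" "{j. Suc j \<in> Suc ` A} = A"
    "{j. Suc j \<notin> Suc ` A} = - A" for A
    by auto
  have "shuffle_mult f g (c # w) =
      (\<Sum>A\<in>(\<lambda>A. insert 0 (Suc ` A)) ` Pow {..<length w} \<union> (`) Suc ` Pow {..<length w}.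
        f (nths (c # w) A) * g (nths (c # w) (- A)))"
    by (simp only: shuffle_mult_def length_Cons split)
  also have "\<dots> = (\<Sum>A\<in>(\<lambda>A. insert 0 (Suc ` A)) ` Pow {..<length w}.
        f (nths (c # w) A) * g (nths (c # w) (- A))) +
      (\<Sum>A\<in>(`) Suc ` Pow {..<length w}. f (nths (c # w) A) * g (nths (c # w) (- A)))"
    by (rule sum.union_disjoint) auto
  also have "\<dots> = shuffle_mult (\<lambda>x. f (c # x)) g w + shuffle_mult f (\<lambda>x. g (c # x)) w"
    unfolding sum.reindex[OF i1] sum.reindex[OF i2] shuffle_mult_def
    by (simp add: nths_Cons c)
  finally show ?thesis .
qed

lemma word_Cons: "(\<lambda>x. word u (c # x)) = (case u of [] \<Rightarrow> 0 | a # u' \<Rightarrow> if a = c then word u' else 0)"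
  by (auto simp: word_def fun_eq_iff split: list.split)

lemma shuffle_mult_0: "shuffle_mult 0 g w = 0" "shuffle_mult f 0 w = 0"
  by (simp_all add: shuffle_mult_def)

lemma shuffle_mult_Nil_left: "shuffle_mult (word []) g w = g w"
  by (induction w arbitrary: g)
     (simp_all add: shuffle_mult_Cons word_Cons shuffle_mult_0, simp_all add: shuffle_mult_Nil word_def)

lemma shuffle_mult_Nil_right: "shuffle_mult f (word []) w = f w"
  by (induction w arbitrary: f)
     (simp_all add: shuffle_mult_Cons word_Cons shuffle_mult_0, simp_all add: shuffle_mult_Nil word_def)

lemma shuffle_mult_word: "shuffle_mult (word u) (word v) = (\<Sum>w\<leftarrow>interleavings u v. word w)"
proof
  have cons: "(\<Sum>x\<leftarrow>xs. word (a # x) w) =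
      (case w of [] \<Rightarrow> 0 | c # w' \<Rightarrow> if a = c then \<Sum>x\<leftarrow>xs. word x w' else 0)" for a xs w
    by (induction xs) (auto simp: word_def split: list.split)
  show "shuffle_mult (word u) (word v) w = (\<Sum>w\<leftarrow>interleavings u v. word w) w" for w
    unfolding sum_list_fun_apply
  proof (induction u v arbitrary: w rule: interleavings.induct)
    case (1 v)
    show ?case by (simp add: shuffle_mult_Nil_left)
  next
    case (2 a u)
    show ?case by (simp add: shuffle_mult_Nil_right)
  next
    case (3 a u b v)
    show ?case
    proof (cases w)
      case Nil
      then show ?thesis by (simp add: shuffle_mult_Nil o_def cons) (simp add: word_def)
    next
      case (Cons c w')
      then show ?thesis
        using 3[of w']
        by (auto simp: shuffle_mult_Cons word_Cons o_def cons shuffle_mult_0)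
    qed
  qed
qed

lemma shuffle_comult_word:
  "shuffle_comult (word w) = (\<Sum>i\<le>length w. tensor (word (take i w)) (word (drop i w)))"
proof
  fix p :: "nat list \<times> nat list"
  obtain u v where p: "p = (u, v)" by force
  have "(\<Sum>i\<le>length w. tensor (word (take i w)) (word (drop i w))) p =
      (\<Sum>i\<le>length w. if i = length u \<and> u @ v = w then 1 else 0)"
    unfolding sum_fun_apply p
  proof (rule sum.cong[OF refl])
    fix i assume "i \<in> {..length w}"
    then have "(u = take i w \<and> v = drop i w) = (i = length u \<and> u @ v = w)"
      by (metis append_eq_conv_conj append_take_drop_id atMost_iff length_take min.absorb2)
    then show "tensor (word (take i w)) (word (drop i w)) (u, v) =
        (if i = length u \<and> u @ v = w then 1 else 0)"
      by (cases "u = take i w"; cases "v = drop i w") (simp_all add: tensor_def word_def del: append_take_drop_id)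
  qed
  also have "\<dots> = (if u @ v = w then 1 else 0)"
    by (cases "u @ v = w") auto
  finally show "shuffle_comult (word w) p =
      (\<Sum>i\<le>length w. tensor (word (take i w)) (word (drop i w))) p"
    by (auto simp: shuffle_comult_def p word_def)
qed

subsection \<open>Quasisymmetric functions\<close>

lemma finite_ps_mult: "finite {(a, b). a + b = (m :: monomial)}"
proof (rule finite_subset)
  let ?E = "{e. \<forall>k. (k \<in> Poly_Mapping.keys m \<longrightarrow> e k \<in> {..Max (Poly_Mapping.lookup m ` Poly_Mapping.keys m)})
      \<and> (k \<notin> Poly_Mapping.keys m \<longrightarrow> e k = 0)}"
  have E: "finite ?E"
    by (rule finite_set_of_finite_funs) auto
  let ?L = "{a. Poly_Mapping.lookup a \<in> ?E}"
  have "inj (Poly_Mapping.lookup :: monomial \<Rightarrow> _)"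
    by (rule injI) (rule poly_mapping_eqI, simp)
  from finite_vimageI[OF E this] have fin: "finite ?L"
    unfolding vimage_def .
  have *: "a \<in> ?L" if "\<And>k. Poly_Mapping.lookup a k \<le> Poly_Mapping.lookup m k" for a
  proof -
    have "Poly_Mapping.lookup a k \<le> Max (Poly_Mapping.lookup m ` Poly_Mapping.keys m)"
      if "k \<in> Poly_Mapping.keys m" for k
      using that \<open>\<And>k. Poly_Mapping.lookup a k \<le> Poly_Mapping.lookup m k\<close>[of k]
      by (meson Max_ge finite_imageI finite_keys image_eqI order_trans)
    moreover have "Poly_Mapping.lookup a k = 0" if "k \<notin> Poly_Mapping.keys m" for k
      using that \<open>\<And>k. Poly_Mapping.lookup a k \<le> Poly_Mapping.lookup m k\<close>[of k]
      by (simp add: in_keys_iff)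
    ultimately show ?thesis by auto
  qed
  show "{(a, b). a + b = m} \<subseteq> ?L \<times> ?L"
  proof (rule subrelI)
    fix a b assume "(a, b) \<in> {(a, b). a + b = m}"
    then have m: "m = a + b" by simp
    have "a \<in> ?L" "b \<in> ?L"
      by (rule *, simp add: m lookup_add)+
    then show "(a, b) \<in> ?L \<times> ?L" by blast
  qed
  show "finite (?L \<times> ?L)" using fin by blast
qed

lemma refines_sum_list: "refines J I \<Longrightarrow> sum_list J = sum_list I"
proof -
  have "sum_list (concat Ks) = sum_list (map sum_list Ks)" for Ks :: "nat list list"
    by (induction Ks) auto
  then show "refines J I \<Longrightarrow> sum_list J = sum_list I"
    unfolding refines_def by metis
qed

lemma composition_length_le: "composition I \<Longrightarrow> length I \<le> sum_list I"
  unfolding composition_def by (induction I) fastforce+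

lemma finite_refinements: "finite {J. composition J \<and> refines J I}"
proof (rule finite_subset)
  show "{J. composition J \<and> refines J I} \<subseteq>
      {J. set J \<subseteq> {..sum_list I} \<and> length J \<le> sum_list I}"
  proof clarify
    fix J assume J: "composition J" "refines J I"
    have "set J \<subseteq> {..sum_list J}" by (auto intro: member_le_sum_list)
    then show "set J \<subseteq> {..sum_list I} \<and> length J \<le> sum_list I"
      using composition_length_le[OF J(1)] refines_sum_list[OF J(2)] by simp
  qed
qed (rule finite_lists_length_le, simp)

lemma lookup_mon:
  assumes "length js = length I" "distinct js"
  shows "Poly_Mapping.lookup (mon js I) x =
    (case map_of (zip js I) x of None \<Rightarrow> 0 | Some i \<Rightarrow> i)"
  using assms
proof (induction js I rule: list_induct2)
  case Nil
  show ?case by (simp add: mon_def)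
next
  case (Cons j js i I)
  have "map_of (zip js I) j = None"
    using Cons by (auto simp: map_of_eq_None_iff dest: set_zip_leftD)
  then have "(case map_of (zip js I) j of None \<Rightarrow> 0 | Some i \<Rightarrow> i) = 0"
    by (simp only: option.case)
  then show ?case
    using Cons by (auto simp: mon_def lookup_add lookup_single when_def)
qed

lemma lookup_mon_nth:
  assumes "length js = length I" "distinct js" "k < length I"
  shows "Poly_Mapping.lookup (mon js I) (js ! k) = I ! k"
  using assms by (simp add: lookup_mon map_of_zip_nth)

lemma keys_mon:
  assumes "length js = length I" "distinct js" "composition I"
  shows "Poly_Mapping.keys (mon js I) = set js"
proof (intro equalityI subsetI)
  fix x assume "x \<in> Poly_Mapping.keys (mon js I)"
  then have "map_of (zip js I) x \<noteq> None"
    using lookup_mon[OF assms(1,2), of x] by (auto simp: in_keys_iff split: option.splits)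
  then show "x \<in> set js" by (metis map_of_SomeD not_None_eq set_zip_leftD)
next
  fix x assume "x \<in> set js"
  then obtain k where k: "k < length I" "x = js ! k"
    using assms(1) by (metis in_set_conv_nth)
  moreover have "I ! k \<ge> 1"
    using assms(3) k by (simp add: composition_def)
  ultimately show "x \<in> Poly_Mapping.keys (mon js I)"
    using lookup_mon_nth[OF assms(1,2)] by (simp add: in_keys_iff)
qed

lemma mon_inj:
  assumes "length js = length I" "sorted_wrt (<) js" "composition I"
    and "length ks = length J" "sorted_wrt (<) ks" "composition J"
    and eq: "mon js I = mon ks J"
  shows "js = ks \<and> I = J"
proof -
  have d: "distinct js" "distinct ks"
    using assms by (auto simp: strict_sorted_iff)
  have "set js = set ks"
    using keys_mon[OF assms(1) d(1) assms(3)] keys_mon[OF assms(4) d(2) assms(6)] eq by simp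
  then have js: "js = ks"
    using assms by (intro strict_sorted_equal) auto
  then have len: "length I = length J" using assms by simp
  have "I = J"
  proof (rule nth_equalityI)
    show "I ! k = J ! k" if "k < length I" for k
      using that lookup_mon_nth[OF assms(1) d(1), of k] lookup_mon_nth[OF assms(4) d(2), of k]
        len js eq by simp
  qed (rule len)
  with js show ?thesis by simp
qed

lemma M_coeff_M:
  assumes "composition I" "composition J"
  shows "M_coeff I (M_qsym J) = (if I = J then 1 else 0)"
proof -
  have *: "{js. length js = length J \<and> sorted_wrt (<) js \<and> mon js J = mon [0..<length I] I} =
      (if I = J then {[0..<length I]} else {})"
    using mon_inj[OF _ _ assms(2) _ _ assms(1), of _ "[0..<length I]"]
    by (auto simp: strict_sorted_iff)
  show ?thesis by (simp add: M_coeff_def M_qsym_def *)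
qed

lemma M_coeff_linear:
  "M_coeff I (f + g) = M_coeff I f + M_coeff I g" "M_coeff I (c *\<^sub>R f) = c * M_coeff I f"
  by (simp_all add: M_coeff_def scaleR_fun_def)

lemma finite_M_coeff: "f \<in> qsym \<Longrightarrow> finite {I. composition I \<and> M_coeff I f \<noteq> 0}"
  unfolding qsym_def
proof (induction rule: span_induct_alt)
  case base
  show ?case by (simp add: M_coeff_def)
next
  case (step c f g)
  then obtain J where J: "f = M_qsym J" "composition J" by blast
  have "{I. composition I \<and> M_coeff I (c *\<^sub>R f + g) \<noteq> 0} \<subseteq>
      insert J {I. composition I \<and> M_coeff I g \<noteq> 0}"
    using J by (auto simp: M_coeff_linear M_coeff_M split: if_splits)
  then show ?case using step by (meson finite_insert finite_subset)
qed

lemma qsym_comult_superset: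
  assumes "finite A" "{I. composition I \<and> M_coeff I f \<noteq> 0} \<subseteq> A" "A \<subseteq> Collect composition"
  shows "qsym_comult f =
    (\<Sum>I\<in>A. M_coeff I f *\<^sub>R (\<Sum>j\<le>length I. tensor (M_qsym (take j I)) (M_qsym (drop j I))))"
  unfolding qsym_comult_def using assms by (intro sum.mono_neutral_left) auto

lemma linear_on_qsym_comult: "linear_on qsym qsym_comult"
  unfolding linear_on_def
proof safe
  fix f g assume fg: "f \<in> qsym" "g \<in> qsym"
  let ?S = "\<lambda>f. {I. composition I \<and> M_coeff I f \<noteq> 0}"
  let ?A = "?S f \<union> ?S g"
  have A: "finite ?A" "?A \<subseteq> Collect composition" using fg finite_M_coeff by auto
  have s: "?S f \<subseteq> ?A" "?S g \<subseteq> ?A" "?S (f + g) \<subseteq> ?A"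
    by (auto simp: M_coeff_linear)
  show "qsym_comult (f + g) = qsym_comult f + qsym_comult g"
    unfolding qsym_comult_superset[OF A(1) s(1) A(2)] qsym_comult_superset[OF A(1) s(2) A(2)]
      qsym_comult_superset[OF A(1) s(3) A(2)]
    by (simp add: M_coeff_linear scaleR_add_left sum.distrib)
next
  fix f and c :: real assume f: "f \<in> qsym"
  let ?S = "\<lambda>f. {I. composition I \<and> M_coeff I f \<noteq> 0}"
  have A: "finite (?S f)" "?S f \<subseteq> Collect composition" using f finite_M_coeff by auto
  have s: "?S (c *\<^sub>R f) \<subseteq> ?S f"
    by (auto simp: M_coeff_linear)
  show "qsym_comult (c *\<^sub>R f) = c *\<^sub>R qsym_comult f"
    unfolding qsym_comult_superset[OF A(1) s A(2)] qsym_comult_superset[OF A(1) order.refl A(2)]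
    by (simp add: M_coeff_linear scaleR_sum_right)
qed

lemma qsym_comult_M:
  assumes "composition I"
  shows "qsym_comult (M_qsym I) = (\<Sum>j\<le>length I. tensor (M_qsym (take j I)) (M_qsym (drop j I)))"
proof -
  have *: "{J. composition J \<and> M_coeff J (M_qsym I) \<noteq> 0} = {I}"
    using assms by (auto simp: M_coeff_M split: if_splits)
  show ?thesis using assms by (simp add: qsym_comult_def * M_coeff_M)
qed

lemma M_qsym_Nil: "M_qsym [] = ps_one"
proof
  fix m :: monomial
  have "{js :: nat list. js = [] \<and> 0 = m} = (if m = 0 then {[]} else {})" by auto
  then show "M_qsym [] m = ps_one m"
    by (simp add: M_qsym_def ps_one_def mon_def cong: conj_cong)
qed

subsection \<open>The coproducts take values in the tensor squares\<close>

lemma shuffle_comult_in_tensor_space: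
  assumes "f \<in> hspace shuffle_hopf"
  shows "hcomult shuffle_hopf f \<in> tensor_space (hspace shuffle_hopf) (hspace shuffle_hopf)"
proof -
  let ?V = "span {word w | w. is_word w}"
  have "shuffle_comult f \<in> tensor_space ?V ?V" if "f \<in> ?V" for f
    using that
  proof (induction rule: span_induct_alt)
    case base
    have "shuffle_comult 0 = 0" by (auto simp: shuffle_comult_def)
    then show ?case unfolding tensor_space_def by (simp only: span_zero)
  next
    case (step c g h)
    then obtain w where w: "g = word w" "is_word w" by blast
    have "is_word (take i w)" "is_word (drop i w)" for i
      using w(2) by (auto simp: is_word_def dest: in_set_takeD in_set_dropD)
    then have "tensor (word (take i w)) (word (drop i w)) \<in> tensor_space ?V ?V" for i
      unfolding tensor_space_def by (blast intro: span_base)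
    then have "shuffle_comult (word w) \<in> tensor_space ?V ?V"
      unfolding shuffle_comult_word tensor_space_def by (blast intro: span_sum)
    moreover have "shuffle_comult (c *\<^sub>R g + h) = c *\<^sub>R shuffle_comult g + shuffle_comult h"
      by (auto simp: shuffle_comult_def scaleR_fun_def)
    ultimately show ?case
      using step w unfolding tensor_space_def by (simp only: span_add span_scale)
  qed
  then show ?thesis using assms by (simp add: shuffle_hopf_def)
qed

lemma qsym_comult_in_tensor_space:
  "hcomult qsym_hopf f \<in> tensor_space (hspace qsym_hopf) (hspace qsym_hopf)"
proof -
  have "tensor (M_qsym (take j I)) (M_qsym (drop j I)) \<in> tensor_space qsym qsym" if "composition I" for I j
  proof -
    have "composition (take j I)" "composition (drop j I)"
      using that by (auto simp: composition_def dest: in_set_takeD in_set_dropD)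
    then show ?thesis unfolding tensor_space_def qsym_def by (blast intro: span_base)
  qed
  then show ?thesis
    unfolding qsym_hopf_def qsym_comult_def tensor_space_def
    by (auto intro!: span_sum span_scale)
qed

subsection \<open>Descent compositions exist and are unique\<close>

lemma partial_sums_less:
  assumes "composition I" "i < j" "j \<le> length I"
  shows "sum_list (take i I) < sum_list (take j I)"
proof -
  have step: "sum_list (take j I) < sum_list (take (Suc j) I)" if "j < length I" for j
  proof -
    have "I ! j \<ge> 1" using assms(1) that by (simp add: composition_def)
    then show ?thesis using that by (simp add: take_Suc_conv_app_nth)
  qed
  show ?thesis
    using assms(2,3)
  proof (induction j)
    case (Suc j)
    then show ?case using step[of j] by (cases "i = j") auto
  qed simp
qed

lemma partial_sums_strict:
  assumes "composition I"
  shows "sorted_wrt (<) (map (\<lambda>j. sum_list (take j I)) [0..<Suc (length I)])"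
  using partial_sums_less[OF assms]
  by (auto simp: sorted_wrt_iff_nth_less simp del: upt_Suc)

lemma composition_eqI:
  assumes "composition I" "composition J" "sum_list I = sum_list J"
    and "\<And>r. 1 \<le> r \<Longrightarrow> r < sum_list I \<Longrightarrow>
      (\<exists>j. 1 \<le> j \<and> j < length I \<and> r = sum_list (take j I)) \<longleftrightarrow>
      (\<exists>j. 1 \<le> j \<and> j < length J \<and> r = sum_list (take j J))"
  shows "I = J"
proof -
  let ?p = "\<lambda>I :: nat list. map (\<lambda>j. sum_list (take j I)) [0..<Suc (length I)]"
  let ?P = "\<lambda>I r. \<exists>j. 1 \<le> j \<and> j < length I \<and> r = sum_list (take j I)"
  have set_p: "set (?p I) =
      insert 0 (insert (sum_list I) {r. 1 \<le> r \<and> r < sum_list I \<and> ?P I r})"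
    if I: "composition I" for I
  proof -
    note lt = partial_sums_less[OF I]
    have "r \<in> set (?p I) \<longleftrightarrow> (\<exists>j\<le>length I. r = sum_list (take j I))" for r
      by (auto simp: less_Suc_eq_le image_iff simp del: upt_Suc)
    moreover have "(\<exists>j\<le>length I. r = sum_list (take j I)) \<longleftrightarrow>
        r = 0 \<or> r = sum_list I \<or> (1 \<le> r \<and> r < sum_list I \<and> ?P I r)" for r
    proof
      assume "\<exists>j\<le>length I. r = sum_list (take j I)"
      then obtain j where j: "j \<le> length I" "r = sum_list (take j I)" by blast
      show "r = 0 \<or> r = sum_list I \<or> (1 \<le> r \<and> r < sum_list I \<and> ?P I r)"
      proof (cases "j = 0 \<or> j = length I")
        case True
        then show ?thesis using j by auto
      next
        case False
        then have "r > 0" "r < sum_list I"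
          using lt[of 0 j] lt[of j "length I"] j by auto
        then show ?thesis using False j by (metis One_nat_def Suc_leI le_neq_implies_less neq0_conv)
      qed
    next
      assume "r = 0 \<or> r = sum_list I \<or> (1 \<le> r \<and> r < sum_list I \<and> ?P I r)"
      then show "\<exists>j\<le>length I. r = sum_list (take j I)"
        by (metis le0 less_imp_le order.refl sum_list.Nil take_0 take_all)
    qed
    ultimately show ?thesis by blast
  qed
  have "set (?p I) = set (?p J)"
    unfolding set_p[OF assms(1)] set_p[OF assms(2)] using assms(3,4) by auto
  then have p: "?p I = ?p J"
    using partial_sums_strict[OF assms(1)] partial_sums_strict[OF assms(2)]
    by (intro strict_sorted_equal) auto
  then have "length (?p I) = length (?p J)" by metis
  then have len: "length I = length J" by simp
  have take: "sum_list (take j I) = sum_list (take j J)" if "j \<le> length I" for j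
    using arg_cong[OF p, of "\<lambda>xs. xs ! j"] that len by (simp del: upt_Suc)
  show ?thesis
  proof (rule nth_equalityI)
    show "I ! k = J ! k" if "k < length I" for k
      using take[of k] take[of "Suc k"] that len by (simp add: take_Suc_conv_app_nth)
  qed (rule len)
qed

lemma ex_descent_composition: "\<exists>I. is_descent_composition w I"
proof (induction w rule: rev_induct)
  case Nil
  show ?case by (rule exI[of _ "[]"]) (simp add: is_descent_composition_def composition_def)
next
  case (snoc x w)
  then obtain I where I: "composition I" "sum_list I = length w"
    and r: "\<And>r. 1 \<le> r \<Longrightarrow> r < length w \<Longrightarrow>
      (w ! (r - 1) > w ! r \<longleftrightarrow> (\<exists>j. 1 \<le> j \<and> j < length I \<and> r = sum_list (take j I)))"
    unfolding is_descent_composition_def by blast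
  have lt: "sum_list (take j I) < length w" if "j < length I" for j
    using partial_sums_less[OF I(1) that] I(2) by simp
  have nth: "(w @ [x]) ! (r - 1) > (w @ [x]) ! r \<longleftrightarrow>
      (if r = length w then last w > x else w ! (r - 1) > w ! r)"
    if "1 \<le> r" "r < length (w @ [x])" for r
    using that by (auto simp: nth_append last_conv_nth)
  show ?case
  proof (cases "w = [] \<or> last w > x")
    case True
    have "is_descent_composition (w @ [x]) (I @ [1])"
      unfolding is_descent_composition_def
    proof (intro conjI allI impI)
      fix s assume s: "1 \<le> s \<and> s < length (w @ [x])"
      have "(\<exists>j. 1 \<le> j \<and> j < length (I @ [1]) \<and> s = sum_list (take j (I @ [1]))) \<longleftrightarrow>
          s = length w \<or> (\<exists>j. 1 \<le> j \<and> j < length I \<and> s = sum_list (take j I))" (is "?l \<longleftrightarrow> ?r")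
      proof
        assume ?l
        then obtain j where j: "1 \<le> j" "j \<le> length I" "s = sum_list (take j I)" by auto
        then show ?r using I(2) by (cases "j = length I") auto
      next
        assume ?r
        then show ?l
        proof
          assume "s = length w"
          moreover have "I \<noteq> []" using s \<open>s = length w\<close> I(2) by auto
          ultimately show ?l using I(2) by (intro exI[of _ "length I"]) (auto simp: Suc_le_eq)
        next
          assume "\<exists>j. 1 \<le> j \<and> j < length I \<and> s = sum_list (take j I)"
          then obtain j where "1 \<le> j" "j < length I" "s = sum_list (take j I)" by blast
          then show ?l by (intro exI[of _ j]) auto
        qed
      qed
      then show "(w @ [x]) ! (s - 1) > (w @ [x]) ! s \<longleftrightarrow>
          (\<exists>j. 1 \<le> j \<and> j < length (I @ [1]) \<and> s = sum_list (take j (I @ [1])))"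
        using nth[of s] r[of s] s True by auto
    qed (use I in \<open>auto simp: composition_def\<close>)
    then show ?thesis by blast
  next
    case False
    then have "I \<noteq> []" using I(2) by auto
    then obtain I' k where I': "I = I' @ [k]" by (metis append_butlast_last_id)
    have "is_descent_composition (w @ [x]) (I' @ [Suc k])"
      unfolding is_descent_composition_def
    proof (intro conjI allI impI)
      fix s assume s: "1 \<le> s \<and> s < length (w @ [x])"
      have "(\<exists>j. 1 \<le> j \<and> j < length (I' @ [Suc k]) \<and> s = sum_list (take j (I' @ [Suc k]))) \<longleftrightarrow>
          (\<exists>j. 1 \<le> j \<and> j < length I \<and> s = sum_list (take j I))"
        by (intro ex_cong1) (auto simp: I')
      then show "(w @ [x]) ! (s - 1) > (w @ [x]) ! s \<longleftrightarrow>
          (\<exists>j. 1 \<le> j \<and> j < length (I' @ [Suc k]) \<and> s = sum_list (take j (I' @ [Suc k])))"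
        using nth[of s] r[of s] s False
        by (cases "s = length w") (auto dest: lt simp del: take_append)
    qed (use I I' in \<open>auto simp: composition_def\<close>)
    then show ?thesis by blast
  qed
qed

lemma is_descent_composition_Des: "is_descent_composition w (Des w)"
proof -
  have "\<exists>!I. is_descent_composition w I"
  proof (rule ex_ex1I[OF ex_descent_composition])
    show "I = J" if "is_descent_composition w I" "is_descent_composition w J" for I J
      using that unfolding is_descent_composition_def by (intro composition_eqI) auto
  qed
  then show ?thesis unfolding Des_def by (rule theI')
qed

end

theory Submission
  imports Defs "HOL-Library.Multiset"
begin

text \<open>
  A morphism to \<open>QSym\<close> is determined by a character \<open>\<zeta>\<close> of the source: the coefficient of \<open>M_I\<close> in
  the image of a word is the product of the values of \<open>\<zeta>\<close> on the segments into which \<open>I\<close> cuts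
  the word.  For words with distinct letters, \<open>F_Des(w)\<close> forces \<open>\<zeta>\<close> to be \<open>1\<close> on increasing words and
  \<open>0\<close> on all others.  This extends to a character of the whole shuffle algebra: give a weakly
  increasing word in which the letter \<open>a\<close> occurs \<open>m_a\<close> times the value \<open>\<Prod>\<^sub>a 1 / m_a!\<close>, since two weakly
  increasing words with letter multiplicities \<open>m_a\<close> and \<open>n_a\<close> have exactly \<open>\<Prod>\<^sub>a (m_a + n_a choose m_a)\<close> weakly increasing interleavings.
\<close>

section \<open>Linear maps on spans and tensor squares, given by kernels on a basis\<close>

section \<open>Linear extension\<close>

lemma linear_onD:
  assumes "linear_on V T"
  shows "f \<in> V \<Longrightarrow> g \<in> V \<Longrightarrow> T (f + g) = T f + T g" "f \<in> V \<Longrightarrow> T (c *\<^sub>R f) = c *\<^sub>R T f"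
  using assms by (auto simp: linear_on_def)

lemma linear_on_subset: "linear_on V T \<Longrightarrow> U \<subseteq> V \<Longrightarrow> linear_on U T"
  unfolding linear_on_def by blast

lemma linear_on_compose:
  assumes "linear_on V S" "linear_on W T" "S ` V \<subseteq> W"
  shows "linear_on V (\<lambda>f. T (S f))"
proof -
  have "S f \<in> W" if "f \<in> V" for f using assms(3) that by blast
  then show ?thesis
    using linear_onD[OF assms(1)] linear_onD[OF assms(2)] by (simp add: linear_on_def)
qed

lemma linear_on_0: "linear_on (span B) T \<Longrightarrow> T 0 = 0"
  using linear_onD(2)[of "span B" T 0 0] by (simp add: span_zero)

lemma linear_on_span_image:
  assumes "linear_on (span B) T" "f \<in> span B" "\<And>b. b \<in> B \<Longrightarrow> T b \<in> span C"
  shows "T f \<in> span C"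
proof -
  \<comment> \<open>Membership is carried along because \<open>T\<close> is known to be linear only
    on \<open>span B\<close>.\<close>
  have "f \<in> span B \<and> T f \<in> span C"
    using assms(2)
  proof (induction rule: span_induct_alt)
    case base
    show ?case using linear_on_0[OF assms(1)] by (simp add: span_zero)
  next
    case (step c b g)
    then show ?case
      by (simp add: linear_onD[OF assms(1)] span_base span_scale span_add assms(3))
  qed
  then show ?thesis ..
qed

lemma linear_on_span_eqI:
  assumes "linear_on (span B) S" "linear_on (span B) T" "f \<in> span B" "\<And>b. b \<in> B \<Longrightarrow> S b = T b"
  shows "S f = T f"
proof -
  have "f \<in> span B \<and> S f = T f"
    using assms(3)
  proof (induction rule: span_induct_alt)
    case base
    show ?case by (simp add: linear_on_0[OF assms(1)] linear_on_0[OF assms(2)] span_zero)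
  next
    case (step c b g)
    then show ?case
      by (simp add: linear_onD[OF assms(1)] linear_onD[OF assms(2)] span_base span_scale span_add
          assms(4))
  qed
  then show ?thesis ..
qed

text \<open>\<open>K x\<close> is the image of the basis vector at \<open>x\<close>. A sum over an
  infinite set is 0 by convention, so linearity is available on finitely supported functions
  only.\<close>

definition lin_ext :: "('x \<Rightarrow> 'y \<Rightarrow> real) \<Rightarrow> ('x \<Rightarrow> real) \<Rightarrow> ('y \<Rightarrow> real)" where
  "lin_ext K f = (\<lambda>y. \<Sum>x | f x \<noteq> 0. f x * K x y)"

text \<open>Provides one index set for several functions with different supports.\<close>

lemma lin_ext_superset:
  assumes "finite A" "{x. f x \<noteq> 0} \<subseteq> A"
  shows "lin_ext K f y = (\<Sum>x\<in>A. f x * K x y)"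
  unfolding lin_ext_def using assms by (intro sum.mono_neutral_left) auto

lemma linear_on_lin_ext: "linear_on {f. finite {x. f x \<noteq> 0}} (lin_ext K)"
  unfolding linear_on_def
proof (intro conjI ballI allI)
  fix f g :: "'a \<Rightarrow> real"
  assume "f \<in> {f. finite {x. f x \<noteq> 0}}" "g \<in> {f. finite {x. f x \<noteq> 0}}"
  then have A: "finite ({x. f x \<noteq> 0} \<union> {x. g x \<noteq> 0})" by simp
  show "lin_ext K (f + g) = lin_ext K f + lin_ext K g"
  proof
    fix y
    have "{x. (f + g) x \<noteq> 0} \<subseteq> {x. f x \<noteq> 0} \<union> {x. g x \<noteq> 0}" by auto
    then show "lin_ext K (f + g) y = (lin_ext K f + lin_ext K g) y"
      using lin_ext_superset[OF A, of f K y] lin_ext_superset[OF A, of g K y]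
        lin_ext_superset[OF A, of "f + g" K y]
      by (simp add: algebra_simps sum.distrib)
  qed
next
  fix f :: "'a \<Rightarrow> real" and c :: real
  assume "f \<in> {f. finite {x. f x \<noteq> 0}}"
  then have A: "finite {x. f x \<noteq> 0}" by simp
  show "lin_ext K (c *\<^sub>R f) = c *\<^sub>R lin_ext K f"
  proof
    fix y
    show "lin_ext K (c *\<^sub>R f) y = (c *\<^sub>R lin_ext K f) y"
      using lin_ext_superset[OF A, of f K y] lin_ext_superset[OF A, of "c *\<^sub>R f" K y]
      by (auto simp: scaleR_fun_def sum_distrib_left mult.assoc)
  qed
qed

lemma finite_support_span:
  assumes "f \<in> span B" "\<And>b. b \<in> B \<Longrightarrow> finite {x. b x \<noteq> (0::real)}"
  shows "finite {x. f x \<noteq> 0}"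
  using assms(1)
proof (induction rule: span_induct_alt)
  case (step c b g)
  have "{x. (c *\<^sub>R b + g) x \<noteq> 0} \<subseteq> {x. b x \<noteq> 0} \<union> {x. g x \<noteq> 0}"
    by (auto simp: scaleR_fun_def)
  then show ?case using step assms(2) by (meson finite_UnI finite_subset)
qed simp

lemma lin_ext_word: "lin_ext K (word w) = K w"
proof -
  have "{u. word w u \<noteq> 0} = {w}" by (auto simp: word_def)
  then show ?thesis by (simp add: lin_ext_def word_def)
qed

text \<open>The sum over the rectangle of supports factors, so the product kernel induces the tensor
  square of \<open>lin_ext K\<close>.\<close>

lemma lin_ext_tensor:
  assumes "finite {x. f x \<noteq> 0}" "finite {y. g y \<noteq> 0}"
  shows "lin_ext (\<lambda>(x, y) (m, n). K x m * K y n) (tensor f g) = tensor (lin_ext K f) (lin_ext K g)"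
proof
  fix p :: "'b \<times> 'b"
  obtain m n where p: "p = (m, n)" by force
  have "lin_ext (\<lambda>(x, y) (m, n). K x m * K y n) (tensor f g) p
      = (\<Sum>z\<in>{x. f x \<noteq> 0} \<times> {y. g y \<noteq> 0}. tensor f g z * (\<lambda>(x, y) (m, n). K x m * K y n) z p)"
    by (rule lin_ext_superset) (use assms in \<open>auto simp: tensor_def\<close>)
  also have "\<dots> = (\<Sum>x | f x \<noteq> 0. \<Sum>y | g y \<noteq> 0. (f x * K x m) * (g y * K y n))"
    unfolding sum.cartesian_product p
    by (intro sum.cong) (auto simp: tensor_def)
  also have "\<dots> = tensor (lin_ext K f) (lin_ext K g) p"
    by (simp add: tensor_def lin_ext_def p sum_product)
  finally show "lin_ext (\<lambda>(x, y) (m, n). K x m * K y n) (tensor f g) p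
      = tensor (lin_ext K f) (lin_ext K g) p" .
qed

lemma finite_support_word: "f \<in> span {word w | w. P w} \<Longrightarrow> finite {x. f x \<noteq> 0}"
  by (erule finite_support_span) (auto simp: word_def)

text \<open>Places the tensor square inside the domain on which \<open>lin_ext\<close> is
  linear.\<close>

lemma finite_support_tensor_space:
  assumes "h \<in> tensor_space (span {word w | w. P w}) (span {word w | w. P w})"
  shows "finite {p. h p \<noteq> 0}"
  using assms unfolding tensor_space_def
proof (rule finite_support_span, clarify)
  fix f g :: "nat list \<Rightarrow> real"
  assume "f \<in> span {word w | w. P w}" "g \<in> span {word w | w. P w}"
  then have "finite ({x. f x \<noteq> 0} \<times> {x. g x \<noteq> 0})" using finite_support_word by auto
  moreover have "{p. tensor f g p \<noteq> 0} \<subseteq> {x. f x \<noteq> 0} \<times> {x. g x \<noteq> 0}"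
    by (auto simp: tensor_def)
  ultimately show "finite {p. tensor f g p \<noteq> 0}" by (rule finite_subset[rotated])
qed

section \<open>Convolution dual to deconcatenation, and cuts of shuffles\<close>

section \<open>Convolution of functions on words\<close>

text \<open>The product of linear functionals on words that is dual to deconcatenation.\<close>

definition conv :: "('a list \<Rightarrow> real) \<Rightarrow> ('a list \<Rightarrow> real) \<Rightarrow> 'a list \<Rightarrow> real" where
  "conv f g w = (\<Sum>k\<le>length w. f (take k w) * g (drop k w))"

lemma conv_Nil: "conv f g [] = f [] * g []"
  by (simp add: conv_def)

text \<open>The cut before the first letter is split off. In every other cut this letter belongs to
  the prefix and is absorbed into \<open>f\<close>, so inductions on the word have to keep
  \<open>f\<close> arbitrary.\<close>

lemma conv_Cons: "conv f g (c # w) = f [] * g (c # w) + conv (\<lambda>x. f (c # x)) g w"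
  by (simp add: conv_def sum.atMost_Suc_shift del: sum.atMost_Suc)

lemma conv_add_left: "conv (\<lambda>x. f x + g x) h w = conv f h w + conv g h w"
  by (simp add: conv_def algebra_simps sum.distrib)

lemma conv_scale_left: "conv (\<lambda>x. c * f x) h w = c * conv f h w"
  by (simp add: conv_def algebra_simps sum_distrib_left)

text \<open>Dual to the coassociativity of deconcatenation.\<close>

lemma conv_assoc: "conv (conv f g) h = conv f (conv g h)"
proof
  show "conv (conv f g) h w = conv f (conv g h) w" for w
  proof (induction w arbitrary: f)
    case (Cons c w)
    then show ?case
      by (simp add: conv_Cons conv_Nil conv_add_left conv_scale_left algebra_simps)
  qed (simp add: conv_Nil)
qed

lemma conv_unit_left: "conv (\<lambda>w. if w = [] then 1 else 0) g = g"
proof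
  show "conv (\<lambda>w. if w = [] then 1 else 0) g w = g w" for w
    by (cases w) (simp_all add: conv_Cons conv_Nil, simp add: conv_def)
qed

lemma conv_unit_right: "conv f (\<lambda>w. if w = [] then 1 else 0) = f"
proof
  show "conv f (\<lambda>w. if w = [] then 1 else 0) w = f w" for w
    by (induction w arbitrary: f) (simp_all add: conv_Cons conv_Nil)
qed

abbreviation shuffle_sum :: "'a list \<Rightarrow> 'a list \<Rightarrow> ('a list \<Rightarrow> real) \<Rightarrow> real" where
  "shuffle_sum u v G \<equiv> \<Sum>w\<leftarrow>interleavings u v. G w"

lemma interleavings_Nil_right: "interleavings u [] = [u]"
  by (cases u) simp_all

lemma mset_interleavings: "w \<in> set (interleavings u v) \<Longrightarrow> mset w = mset u + mset v"
  by (induction u v arbitrary: w rule: interleavings.induct) auto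

lemma shuffle_sum_Cons:
  "shuffle_sum (a # u) (b # v) G =
     shuffle_sum u (b # v) (\<lambda>w. G (a # w)) + shuffle_sum (a # u) v (\<lambda>w. G (b # w))"
  by (simp add: o_def)

text \<open>The coproduct of the shuffle algebra respects products.\<close>

lemma shuffle_sum_splits:
  "shuffle_sum u v (\<lambda>w. \<Sum>i\<le>length w. H (take i w) (drop i w)) =
     (\<Sum>k\<le>length u. \<Sum>l\<le>length v.
        shuffle_sum (take k u) (take l v) (\<lambda>x. shuffle_sum (drop k u) (drop l v) (H x)))"
proof (induction u v arbitrary: H rule: interleavings.induct)
  case (3 a u b v)
  show ?case
    \<comment> \<open>The empty prefix is treated separately; any other prefix starts with
      \<open>a\<close> or \<open>b\<close>, and this letter is absorbed into
      \<open>H\<close>.\<close>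
    using "3.IH"(1)[of "\<lambda>x. H (a # x)"] "3.IH"(2)[of "\<lambda>x. H (b # x)"]
    by (simp only: shuffle_sum_Cons length_Cons sum.atMost_Suc_shift)
      (simp add: shuffle_sum_Cons sum.atMost_Suc_shift sum_list_addf sum.distrib
         interleavings_Nil_right algebra_simps del: sum.atMost_Suc interleavings.simps(3))
qed (simp_all add: interleavings_Nil_right)

text \<open>For \<open>H x y = f x * g y\<close> the inner double sum factors. This is how a
  convolution is evaluated on a shuffle product.\<close>

lemma shuffle_sum_conv:
  "shuffle_sum u v (conv f g) =
     (\<Sum>k\<le>length u. \<Sum>l\<le>length v.
        shuffle_sum (take k u) (take l v) f * shuffle_sum (drop k u) (drop l v) g)"
  using shuffle_sum_splits[where u = u and v = v and H = "\<lambda>x y. f x * g y"]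
  by (simp add: conv_def[abs_def] sum_list_const_mult sum_list_mult_const)

section \<open>The character of the shuffle algebra and its products over segments\<close>

section \<open>The character\<close>

text \<open>Reading from the left, the copies of a letter \<open>a\<close> contribute
  \<open>1 / m_a\<close>, then \<open>1 / (m_a - 1)\<close>, and so on down to 1, which gives
  \<open>1 / m_a!\<close>. The test on \<open>a\<close> leaves only weakly increasing words.\<close>

fun zeta :: "nat list \<Rightarrow> real" where
  "zeta [] = 1"
| "zeta (a # w) = (if \<forall>b\<in>set w. a \<le> b then zeta w / (1 + real (count (mset w) a)) else 0)"

lemma zeta_distinct: "distinct w \<Longrightarrow> zeta w = (if sorted w then 1 else 0)"
  by (induction w) (auto simp: not_in_iff)

text \<open>An interleaving counts only if it starts with a minimal letter. If the two first letters
  differ, only the smaller one can lead; if they agree, both can, and the two contributions add up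
  by a form of Pascal's rule.\<close>

lemma shuffle_sum_zeta: "shuffle_sum u v zeta = zeta u * zeta v"
proof (induction u v rule: interleavings.induct)
  case (3 a u b v)
  \<comment> \<open>All interleavings of \<open>x\<close> and \<open>y\<close> have the same
    multiset of letters, so the test and the denominator for the leading letter \<open>c\<close> are
    constant and factor out.\<close>
  have step: "shuffle_sum x y (\<lambda>w. zeta (c # w)) =
      (if \<forall>d\<in>set x \<union> set y. c \<le> d
       then shuffle_sum x y zeta / (1 + real (count (mset x) c + count (mset y) c)) else 0)"
    for x y :: "nat list" and c
  proof -
    have w: "set w = set x \<union> set y" "count (mset w) c = count (mset x) c + count (mset y) c"
      if "w \<in> set (interleavings x y)" for w
      using mset_interleavings[OF that] by (metis set_mset_mset set_mset_union, simp)
    let ?P = "\<forall>d\<in>set x \<union> set y. c \<le> d"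
    let ?n = "1 + real (count (mset x) c + count (mset y) c)"
    have "shuffle_sum x y (\<lambda>w. zeta (c # w)) = shuffle_sum x y (\<lambda>w. (if ?P then 1 / ?n else 0) * zeta w)"
      by (intro arg_cong[where f = sum_list] map_cong refl) (simp add: w)
    then show ?thesis unfolding sum_list_const_mult by auto
  qed
  \<comment> \<open>Used for the factor with the larger first letter: if that letter is minimal in
    its word, the smaller one does not occur there and leaves the denominator unchanged.\<close>
  have cnt: "count (mset x) c = 0" if "\<forall>d\<in>set x. c' \<le> d" "c < c'" for x :: "nat list" and c c'
    using that by (auto simp: not_in_iff[symmetric])
  consider "a < b" | "b < a" | "a = b" by linarith
  then show ?case
  proof cases
    case 1
    then show ?thesis
      unfolding shuffle_sum_Cons step "3.IH" using cnt[of v b a] by (auto)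
  next
    case 2
    then show ?thesis
      unfolding shuffle_sum_Cons step "3.IH" using cnt[of u a b] by (auto)
  next
    case 3
    \<comment> \<open>Pascal's rule divided by factorials; \<open>p\<close> and \<open>q\<close>
      count the further copies of the common first letter in \<open>u\<close> and
      \<open>v\<close>.\<close>
    have "x / (1 + q) / (2 + p + q) + x / (1 + p) / (2 + p + q) = x / ((1 + p) * (1 + q))"
      if "p \<ge> 0" "q \<ge> 0" for x p q :: real
      using that by (simp add: divide_simps) (simp add: algebra_simps)
    from this[of "real (count (mset u) b)" "real (count (mset v) b)" "zeta u * zeta v"] 3
    show ?thesis
      unfolding shuffle_sum_Cons step "3.IH" by (auto simp: algebra_simps)
  qed
qed (simp_all add: interleavings_Nil_right)

text \<open>The homogeneous component of the character in degree \<open>i\<close>; convolving with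
  it cuts off a segment of length exactly \<open>i\<close>.\<close>

definition zeta_deg :: "nat \<Rightarrow> nat list \<Rightarrow> real" where
  "zeta_deg i w = (if length w = i then zeta w else 0)"

text \<open>The sum over \<open>p\<close> has at most one nonzero term, \<open>p = length u\<close>.
  It is kept as a sum because it will match the ways in which an exponent \<open>i\<close> of one
  variable splits between two factors.\<close>

lemma shuffle_sum_zeta_deg:
  "shuffle_sum u v (zeta_deg i) = (\<Sum>p\<le>i. zeta_deg p u * zeta_deg (i - p) v)"
proof -
  have len: "length w = length u + length v" if "w \<in> set (interleavings u v)" for w
    using mset_interleavings[OF that] by (metis size_mset size_union)
  have "shuffle_sum u v (zeta_deg i) =
      shuffle_sum u v (\<lambda>w. (if length u + length v = i then 1 else 0) * zeta w)"
    by (intro arg_cong[where f = sum_list] map_cong refl) (simp add: len zeta_deg_def)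
  also have "\<dots> = (if length u + length v = i then zeta u * zeta v else 0)"
    unfolding sum_list_const_mult shuffle_sum_zeta by simp
  also have "\<dots> = (\<Sum>p\<le>i. if p = length u then
      (if length u + length v = i then zeta u * zeta v else 0) else 0)"
    by auto
  also have "\<dots> = (\<Sum>p\<le>i. zeta_deg p u * zeta_deg (i - p) v)"
    by (intro sum.cong) (auto simp: zeta_deg_def)
  finally show ?thesis .
qed

fun seg_prod :: "nat list \<Rightarrow> nat list \<Rightarrow> real" where
  "seg_prod [] = (\<lambda>w. if w = [] then 1 else 0)"
| "seg_prod (i # I) = conv (zeta_deg i) (seg_prod I)"

lemma seg_prod_append: "seg_prod (I @ J) = conv (seg_prod I) (seg_prod J)"
  by (induction I) (simp_all add: conv_assoc conv_unit_left)

lemma zeta_deg_0: "zeta_deg 0 = (\<lambda>w. if w = [] then 1 else 0)"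
  by (auto simp: zeta_deg_def)

text \<open>\<open>zeta_deg 0\<close> is the unit of convolution.\<close>

lemma seg_prod_filter_nonzero: "seg_prod (filter (\<lambda>i. i \<noteq> 0) I) = seg_prod I"
  by (induction I) (auto simp: zeta_deg_0 conv_unit_left)

lemma seg_prod_Cons:
  "seg_prod (i # I) w = (if i \<le> length w then zeta (take i w) * seg_prod I (drop i w) else 0)"
proof -
  have "seg_prod (i # I) w = (\<Sum>k\<le>length w. if k = i then zeta (take i w) * seg_prod I (drop i w) else 0)"
    unfolding seg_prod.simps conv_def by (intro sum.cong) (auto simp: zeta_deg_def)
  then show ?thesis by simp
qed

lemma seg_prod_eq_0: "sum_list I \<noteq> length w \<Longrightarrow> seg_prod I w = 0"
  by (induction I arbitrary: w) (auto simp: seg_prod_Cons simp del: seg_prod.simps(2))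

section \<open>Coefficients of power series and multiplicativity, one variable at a time\<close>

section \<open>Coefficients of monomials\<close>

text \<open>The unique composition \<open>I\<close> for which \<open>m\<close> is a summand of
  \<open>M_qsym I\<close>.\<close>

definition exponents :: "monomial \<Rightarrow> nat list" where
  "exponents m = map (Poly_Mapping.lookup m) (sorted_list_of_set (Poly_Mapping.keys m))"

lemma composition_exponents: "composition (exponents m)"
  by (auto simp: composition_def exponents_def in_keys_iff Suc_le_eq)

lemma mon_exponents: "mon (sorted_list_of_set (Poly_Mapping.keys m)) (exponents m) = m"
proof (rule poly_mapping_eqI)
  fix k
  let ?js = "sorted_list_of_set (Poly_Mapping.keys m)"
  have js: "length ?js = length (exponents m)" "distinct ?js"
    by (simp_all add: exponents_def)
  show "Poly_Mapping.lookup (mon ?js (exponents m)) k = Poly_Mapping.lookup m k"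
  proof (cases "k \<in> Poly_Mapping.keys m")
    case True
    then have "k \<in> set ?js" by simp
    then obtain i where "i < length ?js" "?js ! i = k" by (metis in_set_conv_nth)
    then show ?thesis
      using lookup_mon_nth[OF js, of i] js(1) by (simp add: exponents_def)
  next
    case False
    then have "k \<notin> Poly_Mapping.keys (mon ?js (exponents m))"
      by (simp add: keys_mon[OF js composition_exponents])
    then show ?thesis using False by (simp add: in_keys_iff)
  qed
qed

text \<open>\<open>mon_exponents\<close> supplies the one possible summand equal to
  \<open>m\<close>, and \<open>mon_inj\<close> excludes all others.\<close>

lemma M_qsym_eq:
  assumes "composition I"
  shows "M_qsym I m = (if I = exponents m then 1 else 0)"
proof -
  let ?js = "sorted_list_of_set (Poly_Mapping.keys m)"
  have js: "length ?js = length (exponents m)" "sorted_wrt (<) ?js"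
    by (simp_all add: exponents_def)
  have uniq: "js = ?js \<and> I = exponents m"
    if "length js = length I" "sorted_wrt (<) js" "mon js I = m" for js
  proof (rule mon_inj[OF that(1,2) assms js composition_exponents])
    show "mon js I = mon ?js (exponents m)" using that(3) by (rule trans[OF _ mon_exponents[symmetric]])
  qed
  let ?S = "{js. length js = length I \<and> sorted_wrt (<) js \<and> mon js I = m}"
  show ?thesis
  proof (cases "I = exponents m")
    case True
    have "?js \<in> ?S" unfolding True using js mon_exponents by blast
    moreover have "?S \<subseteq> {?js}" using uniq by blast
    ultimately have "?S = {?js}" by blast
    then show ?thesis unfolding M_qsym_def using True by (simp del: mem_Collect_eq)
  next
    case False
    then have "?S = {}" using uniq by blast
    then show ?thesis unfolding M_qsym_def using False by (simp only: if_False card.empty of_nat_0)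
  qed
qed

lemma exponents_mon:
  assumes "composition I"
  shows "exponents (mon [0..<length I] I) = I"
\<comment> \<open>Otherwise \<open>M_qsym_eq\<close> would make the diagonal coefficient 0, against
  \<open>M_coeff_M\<close>.\<close>
proof (rule ccontr)
  assume "exponents (mon [0..<length I] I) \<noteq> I"
  then have "M_coeff I (M_qsym I) = 0"
    unfolding M_coeff_def M_qsym_eq[OF assms] by auto
  then show False using M_coeff_M[OF assms assms] by simp
qed

text \<open>Zeros are kept, so the length is fixed and products of monomials add these lists
  entrywise; this permits induction on the number of variables.\<close>

definition coeffs_below :: "nat \<Rightarrow> monomial \<Rightarrow> nat list" where
  "coeffs_below N m = map (Poly_Mapping.lookup m) [0..<N]"

lemma seg_prod_exponents:
  assumes "Poly_Mapping.keys m \<subseteq> {..<N}"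
  shows "seg_prod (exponents m) = seg_prod (coeffs_below N m)"
proof -
  have "sorted_list_of_set (Poly_Mapping.keys m) = filter (\<lambda>k. Poly_Mapping.lookup m k \<noteq> 0) [0..<N]"
    using assms by (intro strict_sorted_equal)
      (auto simp: sorted_wrt_filter in_keys_iff subset_iff)
  then have "exponents m = filter (\<lambda>i. i \<noteq> 0) (coeffs_below N m)"
    by (simp add: exponents_def coeffs_below_def filter_map o_def)
  then show ?thesis by (simp only: seg_prod_filter_nonzero)
qed

lemma sum_swap_pairs:
  "(\<Sum>a\<in>A. \<Sum>b\<in>B. \<Sum>c\<in>C. \<Sum>d\<in>D. f a b c d) = (\<Sum>c\<in>C. \<Sum>d\<in>D. \<Sum>a\<in>A. \<Sum>b\<in>B. f a b c d)"
  by (simp only: sum.swap[where A = B and B = C] sum.swap[where A = B and B = D]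
      sum.swap[where A = A and B = C] sum.swap[where A = A and B = D])

text \<open>A convolution of characters is again a character. In each step the last variable is
  removed: its exponent is distributed over the two factors, and correspondingly the last segment of
  an interleaving is an interleaving of final segments of \<open>u\<close> and
  \<open>v\<close>.\<close>

lemma seg_prod_coeffs_below_mult:
  assumes "Poly_Mapping.keys m \<subseteq> {..<N}"
  shows "(\<Sum>(a, b)\<in>{(a, b). a + b = m}. seg_prod (coeffs_below N a) u * seg_prod (coeffs_below N b) v)
    = shuffle_sum u v (seg_prod (coeffs_below N m))"
  using assms
proof (induction N arbitrary: m u v)
  case 0
  then have m: "m = 0" by simp
  have zero: "a = 0 \<and> b = 0" if "a + b = 0" for a b :: monomial
  proof -
    have "Poly_Mapping.lookup a k + Poly_Mapping.lookup b k = 0" for k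
      using that by (metis lookup_add lookup_zero)
    then show ?thesis by (intro conjI poly_mapping_eqI) simp_all
  qed
  have pairs: "{(a, b). a + b = m} = {(0, 0)}"
  proof
    show "{(a, b). a + b = m} \<subseteq> {(0, 0)}" unfolding m using zero by blast
    show "{(0, 0)} \<subseteq> {(a, b). a + b = m}" unfolding m by simp
  qed
  \<comment> \<open>With no variables left the functional is the counit, which is multiplicative:
    only two empty words have an empty interleaving.\<close>
  have "shuffle_sum u v (\<lambda>w. if w = [] then 1 else 0) =
      (if u = [] then 1 else 0) * (if v = [] then 1 else 0)"
    by (induction u v rule: interleavings.induct)
      (simp_all only: shuffle_sum_Cons, simp_all)
  then show ?case by (simp add: coeffs_below_def pairs)
next
  case (Suc N)
  define i where "i = Poly_Mapping.lookup m N"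
  define m' where "m' = m - Poly_Mapping.single N i"
  have m: "m = m' + Poly_Mapping.single N i"
    by (rule poly_mapping_eqI) (simp add: m'_def i_def lookup_add lookup_minus lookup_single when_def)
  have m'N: "Poly_Mapping.lookup m' N = 0"
    by (simp add: m'_def i_def lookup_minus lookup_single)
  have "Poly_Mapping.keys m' \<subseteq> {..<N}"
  proof
    fix k assume "k \<in> Poly_Mapping.keys m'"
    then have "k \<noteq> N" "k \<in> Poly_Mapping.keys m"
      using m'N by (auto simp: in_keys_iff m'_def i_def lookup_minus lookup_single when_def split: if_splits)
    then show "k \<in> {..<N}" using Suc.prems by fastforce
  qed
  note IH = Suc.IH[OF this]
  \<comment> \<open>Restoring the variable \<open>N\<close> with exponent \<open>p\<close> appends
    one segment of length \<open>p\<close>.\<close>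
  have below: "seg_prod (coeffs_below (Suc N) (a + Poly_Mapping.single N p)) =
      conv (seg_prod (coeffs_below N a)) (zeta_deg p)" if "Poly_Mapping.lookup a N = 0" for a p
  proof -
    have "coeffs_below (Suc N) (a + Poly_Mapping.single N p) = coeffs_below N a @ [p]"
      using that by (simp add: coeffs_below_def lookup_add lookup_single)
    then show ?thesis by (simp add: seg_prod_append conv_unit_right)
  qed
  let ?S = "{(a, b). a + b = m'}"
  have zero: "Poly_Mapping.lookup a N = 0 \<and> Poly_Mapping.lookup b N = 0" if "(a, b) \<in> ?S" for a b
    using that m'N by (auto simp: lookup_add)
  have split_last: "a - Poly_Mapping.single N (Poly_Mapping.lookup a N) +
      Poly_Mapping.single N (Poly_Mapping.lookup a N) = a" for a :: monomial
    by (rule poly_mapping_eqI) (simp add: lookup_add lookup_minus lookup_single when_def)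
  let ?f = "\<lambda>a b. seg_prod (coeffs_below (Suc N) a) u * seg_prod (coeffs_below (Suc N) b) v"
  \<comment> \<open>A factorization of \<open>m\<close> amounts to a factorization of
    \<open>m'\<close> together with the exponent \<open>p\<close> of the variable \<open>N\<close>
    in the first factor; the second factor receives \<open>i - p\<close>.\<close>
  have "(\<Sum>(a, b)\<in>{(a, b). a + b = m}. ?f a b) =
      (\<Sum>((a, b), p)\<in>?S \<times> {..i}.
         ?f (a + Poly_Mapping.single N p) (b + Poly_Mapping.single N (i - p)))"
  proof (rule sum.reindex_bij_witness[where
        j = "\<lambda>(a, b). ((a - Poly_Mapping.single N (Poly_Mapping.lookup a N),
               b - Poly_Mapping.single N (Poly_Mapping.lookup b N)), Poly_Mapping.lookup a N)"
        and i = "\<lambda>((a, b), p). (a + Poly_Mapping.single N p, b + Poly_Mapping.single N (i - p))"],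
      goal_cases)
    case (1 x)
    then obtain a b where x: "x = (a, b)" and ab: "a + b = m" by auto
    have "i - Poly_Mapping.lookup a N = Poly_Mapping.lookup b N" by (simp add: i_def ab[symmetric] lookup_add)
    then show ?case using split_last x by simp
  next
    case (2 x)
    then obtain a b where x: "x = (a, b)" and ab: "a + b = m" by auto
    have "a - Poly_Mapping.single N (Poly_Mapping.lookup a N) +
        (b - Poly_Mapping.single N (Poly_Mapping.lookup b N)) = m'"
      by (rule poly_mapping_eqI)
        (simp add: m'_def i_def ab[symmetric] lookup_add lookup_minus lookup_single when_def)
    moreover have "Poly_Mapping.lookup a N \<le> i" by (simp add: i_def ab[symmetric] lookup_add)
    ultimately show ?case using x by simp
  next
    case (3 y)
    then obtain a b p where y: "y = ((a, b), p)" "a + b = m'" "p \<le> i" by auto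
    then have "Poly_Mapping.lookup a N = 0" "Poly_Mapping.lookup b N = 0" using zero by auto
    then show ?case using y by (simp add: lookup_add)
  next
    case (4 y)
    then obtain a b p where y: "y = ((a, b), p)" "a + b = m'" "p \<le> i" by auto
    have "a + Poly_Mapping.single N p + (b + Poly_Mapping.single N (i - p)) =
        (a + b) + (Poly_Mapping.single N p + Poly_Mapping.single N (i - p))"
      by (simp only: ac_simps)
    also have "\<dots> = m" using y m by (simp add: single_add[symmetric])
    finally show ?case using y by simp
  next
    case (5 x)
    then obtain a b where x: "x = (a, b)" and ab: "a + b = m" by auto
    have "i - Poly_Mapping.lookup a N = Poly_Mapping.lookup b N" by (simp add: i_def ab[symmetric] lookup_add)
    then show ?case using split_last x by simp
  qed
  also have "\<dots> = (\<Sum>(a, b)\<in>?S. \<Sum>p\<le>i.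
      conv (seg_prod (coeffs_below N a)) (zeta_deg p) u * conv (seg_prod (coeffs_below N b)) (zeta_deg (i - p)) v)"
    unfolding sum.cartesian_product[symmetric]
  proof (intro sum.cong refl, clarify)
    fix a b assume "m' = a + b"
    then have "Poly_Mapping.lookup a N = 0" "Poly_Mapping.lookup b N = 0" using zero by auto
    then show "(\<Sum>p\<le>i. ?f (a + Poly_Mapping.single N p) (b + Poly_Mapping.single N (i - p))) =
        (\<Sum>p\<le>i. conv (seg_prod (coeffs_below N a)) (zeta_deg p) u *
          conv (seg_prod (coeffs_below N b)) (zeta_deg (i - p)) v)"
      by (simp only: below)
  qed
  also have "\<dots> = (\<Sum>(a, b)\<in>?S. \<Sum>p\<le>i. \<Sum>k\<le>length u. \<Sum>l\<le>length v.
      (seg_prod (coeffs_below N a) (take k u) * seg_prod (coeffs_below N b) (take l v)) *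
      (zeta_deg p (drop k u) * zeta_deg (i - p) (drop l v)))"
    unfolding conv_def sum_product by (simp only: mult_ac)
  also have "\<dots> = (\<Sum>k\<le>length u. \<Sum>l\<le>length v. \<Sum>(a, b)\<in>?S. \<Sum>p\<le>i.
      (seg_prod (coeffs_below N a) (take k u) * seg_prod (coeffs_below N b) (take l v)) *
      (zeta_deg p (drop k u) * zeta_deg (i - p) (drop l v)))"
    unfolding case_prod_unfold by (rule sum_swap_pairs)
  also have "\<dots> = (\<Sum>k\<le>length u. \<Sum>l\<le>length v.
      (\<Sum>(a, b)\<in>?S. seg_prod (coeffs_below N a) (take k u) * seg_prod (coeffs_below N b) (take l v)) *
      (\<Sum>p\<le>i. zeta_deg p (drop k u) * zeta_deg (i - p) (drop l v)))"
    unfolding sum_product case_prod_unfold ..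
  also have "\<dots> = shuffle_sum u v (conv (seg_prod (coeffs_below N m')) (zeta_deg i))"
    unfolding shuffle_sum_conv shuffle_sum_zeta_deg IH ..
  also have "conv (seg_prod (coeffs_below N m')) (zeta_deg i) = seg_prod (coeffs_below (Suc N) m)"
    unfolding below[OF m'N, symmetric] m[symmetric] ..
  finally show ?case .
qed

text \<open>Both factors of \<open>m\<close> involve only variables of \<open>m\<close>, so one
  bound \<open>N\<close> serves all factorizations.\<close>

lemma ps_mult_seg_prod:
  "ps_mult (\<lambda>m. seg_prod (exponents m) u) (\<lambda>m. seg_prod (exponents m) v) m = shuffle_sum u v (seg_prod (exponents m))"
proof -
  obtain N where N: "Poly_Mapping.keys m \<subseteq> {..<N}"
    using finite_nat_set_iff_bounded[of "Poly_Mapping.keys m"] finite_keys[of m] by blast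
  have "ps_mult (\<lambda>m. seg_prod (exponents m) u) (\<lambda>m. seg_prod (exponents m) v) m =
      (\<Sum>(a, b)\<in>{(a, b). a + b = m}. seg_prod (coeffs_below N a) u * seg_prod (coeffs_below N b) v)"
    unfolding ps_mult_def
  proof (intro sum.cong refl, clarify)
    fix a b assume ab: "m = a + b"
    have "Poly_Mapping.keys a \<subseteq> {..<N}" "Poly_Mapping.keys b \<subseteq> {..<N}"
      using N unfolding ab by (auto simp: in_keys_iff lookup_add subset_iff)
    then show "seg_prod (exponents a) u * seg_prod (exponents b) v =
        seg_prod (coeffs_below N a) u * seg_prod (coeffs_below N b) v"
      by (simp add: seg_prod_exponents)
  qed
  then show ?thesis by (simp add: seg_prod_coeffs_below_mult[OF N] seg_prod_exponents[OF N])
qed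

section \<open>Images of words, their degrees and their coproducts\<close>

section \<open>The morphism\<close>

text \<open>Given by coefficients of monomials, which suits products; the expansion in the basis of
  the \<open>M_qsym I\<close> follows in \<open>theta_word_eq_sum\<close>.\<close>

definition theta_word :: "nat list \<Rightarrow> power_series" where
  "theta_word w = (\<lambda>m. seg_prod (exponents m) w)"

definition compositions :: "nat \<Rightarrow> nat list set" where
  "compositions n = {I. composition I \<and> sum_list I = n}"

lemma finite_compositions: "finite (compositions n)"
proof (rule finite_subset)
  show "compositions n \<subseteq> {I. set I \<subseteq> {..n} \<and> length I \<le> n}"
    using composition_length_le by (auto simp: compositions_def intro: member_le_sum_list)
qed (rule finite_lists_length_le, simp)

text \<open>At \<open>m\<close> only \<open>I = exponents m\<close> contributes, and
  \<open>seg_prod_eq_0\<close> covers the case that this composition has the wrong size. The finite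
  sum shows that the image is quasisymmetric and homogeneous.\<close>

lemma theta_word_eq_sum: "theta_word w = (\<Sum>I\<in>compositions (length w). seg_prod I w *\<^sub>R M_qsym I)"
proof
  fix m
  have "(\<Sum>I\<in>compositions (length w). seg_prod I w *\<^sub>R M_qsym I) m =
      (\<Sum>I\<in>compositions (length w). if I = exponents m then seg_prod I w else 0)"
    unfolding sum_fun_apply
    by (intro sum.cong) (auto simp: scaleR_fun_def compositions_def M_qsym_eq)
  also have "\<dots> = seg_prod (exponents m) w"
    by (subst sum.delta[OF finite_compositions])
      (auto simp: compositions_def composition_exponents seg_prod_eq_0)
  finally show "theta_word w m = (\<Sum>I\<in>compositions (length w). seg_prod I w *\<^sub>R M_qsym I) m"
    by (simp add: theta_word_def)
qed

lemma theta_word_in_span: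
  "theta_word w \<in> span {M_qsym I | I. composition I \<and> sum_list I = length w}"
  unfolding theta_word_eq_sum
  by (intro span_sum span_scale span_base) (auto simp: compositions_def)

lemma theta_word_Nil: "theta_word [] = ps_one"
proof -
  have "I = []" if "I \<in> compositions 0" for I
    using that composition_length_le[of I] by (simp add: compositions_def del: sum_list_eq_0_iff)
  moreover have "[] \<in> compositions 0" by (simp add: compositions_def composition_def)
  ultimately have "compositions 0 = {[]}" by blast
  then show ?thesis by (simp add: theta_word_eq_sum M_qsym_Nil)
qed

text \<open>The coefficient at \<open>(m, n)\<close> comes only from
  \<open>exponents m @ exponents n\<close>, cut between the two lists;
  \<open>seg_prod_append\<close> turns this concatenation into a convolution.\<close>

lemma qsym_comult_theta_word:
  "qsym_comult (theta_word w) (m, n) = conv (seg_prod (exponents m)) (seg_prod (exponents n)) w"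
proof -
  let ?A = "compositions (length w)"
  have coeff: "M_coeff I (theta_word w) = seg_prod I w" if "composition I" for I
    using that by (simp add: M_coeff_def theta_word_def exponents_mon)
  have "qsym_comult (theta_word w) =
      (\<Sum>I\<in>?A. M_coeff I (theta_word w) *\<^sub>R (\<Sum>j\<le>length I. tensor (M_qsym (take j I)) (M_qsym (drop j I))))"
    by (rule qsym_comult_superset[OF finite_compositions])
      (use seg_prod_eq_0 in \<open>force simp: coeff compositions_def\<close>)+
  then have "qsym_comult (theta_word w) (m, n) =
      (\<Sum>I\<in>?A. seg_prod I w * (\<Sum>j\<le>length I. M_qsym (take j I) m * M_qsym (drop j I) n))"
    by (auto simp: sum_fun_apply scaleR_fun_def tensor_def compositions_def coeff intro!: sum.cong)
  also have "\<dots> = (\<Sum>I\<in>?A. if I = exponents m @ exponents n then seg_prod I w else 0)"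
  proof (intro sum.cong refl)
    fix I assume "I \<in> ?A"
    then have comp: "composition (take j I)" "composition (drop j I)" for j
      by (auto simp: compositions_def composition_def dest: in_set_takeD in_set_dropD)
    have "(\<Sum>j\<le>length I. M_qsym (take j I) m * M_qsym (drop j I) n) =
        (\<Sum>j\<le>length I. if j = length (exponents m) then
           (if I = exponents m @ exponents n then 1 else 0) else 0)"
    proof (intro sum.cong refl)
      fix j assume "j \<in> {..length I}"
      then have "(take j I = exponents m \<and> drop j I = exponents n) \<longleftrightarrow>
          (j = length (exponents m) \<and> I = exponents m @ exponents n)"
        by (metis append_eq_conv_conj append_take_drop_id atMost_iff length_take min.absorb2)
      then show "M_qsym (take j I) m * M_qsym (drop j I) n =
          (if j = length (exponents m) then (if I = exponents m @ exponents n then 1 else 0) else 0)"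
        by (auto simp: M_qsym_eq[OF comp(1)] M_qsym_eq[OF comp(2)])
    qed
    then show "seg_prod I w * (\<Sum>j\<le>length I. M_qsym (take j I) m * M_qsym (drop j I) n) =
        (if I = exponents m @ exponents n then seg_prod I w else 0)"
      by auto
  qed
  also have "\<dots> = seg_prod (exponents m @ exponents n) w"
  proof (subst sum.delta[OF finite_compositions])
    have "composition (exponents m @ exponents n)"
      using composition_exponents[of m] composition_exponents[of n] by (auto simp: composition_def)
    then show "(if exponents m @ exponents n \<in> ?A then seg_prod (exponents m @ exponents n) w else 0)
        = seg_prod (exponents m @ exponents n) w"
      using seg_prod_eq_0[of "exponents m @ exponents n" w]
      unfolding compositions_def mem_Collect_eq by metis
  qed
  finally show ?thesis by (simp add: seg_prod_append)
qed

section \<open>Refinements, descents and fundamental quasisymmetric functions\<close>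

section \<open>Words with distinct letters\<close>

lemma refinesI: "\<forall>K\<in>set Ks. K \<noteq> [] \<Longrightarrow> refines (concat Ks) (map sum_list Ks)"
  unfolding refines_def by blast

lemma refinesE:
  assumes "refines J I"
  obtains Ks where "\<forall>K\<in>set Ks. K \<noteq> []" "J = concat Ks" "I = map sum_list Ks"
  using assms unfolding refines_def by blast

lemma refines_Nil_left: "refines [] I \<longleftrightarrow> I = []"
proof
  assume "refines [] I"
  then obtain Ks where "\<forall>K\<in>set Ks. K \<noteq> []" "[] = concat Ks" "I = map sum_list Ks"
    by (rule refinesE)
  then show "I = []" by (cases Ks) simp_all
qed (use refinesI[of "[]"] in simp)

lemma refines_Nil_right: "refines J [] \<longleftrightarrow> J = []"
  by (auto elim: refinesE simp: refines_Nil_left)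

text \<open>The block of \<open>i # J\<close> that sums to \<open>c\<close> is either
  \<open>[i]\<close> or continues after \<open>i\<close>; in the second case the rest of the block
  has the positive sum \<open>c - i\<close>.\<close>

lemma refines_Cons_Cons:
  assumes "composition (i # J)"
  shows "refines (i # J) (c # I) \<longleftrightarrow> i = c \<and> refines J I \<or> i < c \<and> refines J ((c - i) # I)"
    (is "?l \<longleftrightarrow> ?r")
proof
  assume ?l
  then obtain Ks where Ks: "\<forall>K\<in>set Ks. K \<noteq> []" "i # J = concat Ks" "c # I = map sum_list Ks"
    by (rule refinesE)
  from Ks(3) obtain K0 Ls where K0: "Ks = K0 # Ls" by (cases Ks) simp_all
  from Ks(1) K0 obtain k K where "K0 = k # K" by (cases K0) simp_all
  with Ks K0 have K: "J = K @ concat Ls" "c = i + sum_list K" "I = map sum_list Ls"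
      "\<forall>L\<in>set Ls. L \<noteq> []"
    by simp_all
  note ref = refinesI[OF K(4)]
  show ?r
  proof (cases K)
    case Nil
    then show ?thesis using ref K by simp
  next
    case (Cons k' K')
    then have "sum_list K > 0"
      using K(1) assms by (simp add: composition_def)
    moreover have "refines J (sum_list K # I)"
      using refinesI[of "K # Ls"] K Cons by simp
    ultimately show ?thesis using K(2) by simp
  qed
next
  assume ?r
  then show ?l
  proof (elim disjE conjE)
    assume ic: "i = c" and "refines J I"
    from this(2) obtain Ks where "\<forall>K\<in>set Ks. K \<noteq> []" "J = concat Ks" "I = map sum_list Ks"
      by (rule refinesE)
    then show ?l using refinesI[of "[i] # Ks"] ic by simp
  next
    assume ic: "i < c" and "refines J ((c - i) # I)"
    from this(2) obtain Ks where Ks: "\<forall>K\<in>set Ks. K \<noteq> []" "J = concat Ks" "(c - i) # I = map sum_list Ks"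
      by (rule refinesE)
    from Ks(3) obtain K Ls where K: "Ks = K # Ls" by (cases Ks) simp_all
    then have "c - i = sum_list K" using Ks(3) by simp
    then have "i + sum_list K = c" using ic by linarith
    then show ?l using refinesI[of "(i # K) # Ls"] Ks K by simp
  qed
qed

text \<open>The total sum does not count as an inner partial sum, so \<open>c\<close> is one only if
  \<open>I\<close> is nonempty.\<close>

lemma inner_partial_sum_Cons:
  "(\<exists>j. 1 \<le> j \<and> j < length (c # I) \<and> r = sum_list (take j (c # I))) \<longleftrightarrow>
     I \<noteq> [] \<and> (r = c \<or> (\<exists>j. 1 \<le> j \<and> j < length I \<and> r = c + sum_list (take j I)))"
  (is "?l \<longleftrightarrow> ?r")
proof
  assume ?l
  then obtain j where j: "1 \<le> j" "j < length (c # I)" "r = sum_list (take j (c # I))" by blast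
  then obtain k where k: "j = Suc k" by (cases j) auto
  show ?r using j k by (cases "k = 0") (auto simp: Suc_le_eq)
next
  assume ?r
  then consider "I \<noteq> []" "r = c" | j where "1 \<le> j" "j < length I" "r = c + sum_list (take j I)"
    by blast
  then show ?l
  proof cases
    case 1
    then show ?thesis by (intro exI[of _ 1]) auto
  next
    case (2 j)
    then show ?thesis by (intro exI[of _ "Suc j"]) auto
  qed
qed

text \<open>The last two claims describe the word after removal of a prefix that ends at or before
  the first descent, in the two forms occurring in \<open>refines_Cons_Cons\<close>.\<close>

lemma is_descent_composition_Cons:
  assumes "is_descent_composition w (c # I)"
  shows "r < c \<Longrightarrow> 1 \<le> r \<Longrightarrow> w ! (r - 1) \<le> w ! r"
    and "c < length w \<Longrightarrow> w ! (c - 1) > w ! c"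
    and "is_descent_composition (drop c w) I"
    and "i < c \<Longrightarrow> is_descent_composition (drop i w) ((c - i) # I)"
proof -
  have I: "composition I" "c \<ge> 1" "c + sum_list I = length w"
    using assms by (auto simp: is_descent_composition_def composition_def)
  have desc: "w ! (r - 1) > w ! r \<longleftrightarrow>
      I \<noteq> [] \<and> (r = c \<or> (\<exists>j. 1 \<le> j \<and> j < length I \<and> r = c + sum_list (take j I)))"
    if "1 \<le> r" "r < length w" for r
    using assms that unfolding is_descent_composition_def inner_partial_sum_Cons by blast
  show "w ! (r - 1) \<le> w ! r" if "r < c" "1 \<le> r"
    using desc[of r] that I(3) by auto
  show "w ! (c - 1) > w ! c" if "c < length w"
    using desc[of c] that I by auto
  show "is_descent_composition (drop c w) I"
    unfolding is_descent_composition_def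
  proof (intro conjI allI impI)
    fix r assume r: "1 \<le> r \<and> r < length (drop c w)"
    then have "c + r - 1 = c + (r - 1)" by simp
    then show "drop c w ! (r - 1) > drop c w ! r \<longleftrightarrow>
        (\<exists>j. 1 \<le> j \<and> j < length I \<and> r = sum_list (take j I))"
      using desc[of "c + r"] r by auto
  qed (use I in auto)
  show "is_descent_composition (drop i w) ((c - i) # I)" if "i < c"
    unfolding is_descent_composition_def inner_partial_sum_Cons
  proof (intro conjI allI impI)
    fix r assume r: "1 \<le> r \<and> r < length (drop i w)"
    then have "i \<le> length w" "i + r < length w" by auto
    from r have "i + r - 1 = i + (r - 1)" by simp
    moreover have "i + r = c + x \<longleftrightarrow> r = c - i + x" for x using that by auto
    moreover have "i + r = c \<longleftrightarrow> r = c - i" using that by auto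
    ultimately show "drop i w ! (r - 1) > drop i w ! r \<longleftrightarrow> I \<noteq> [] \<and>
        (r = c - i \<or> (\<exists>j. 1 \<le> j \<and> j < length I \<and> r = c - i + sum_list (take j I)))"
      using desc[of "i + r"] r \<open>i \<le> length w\<close> \<open>i + r < length w\<close> by simp
  qed (use I that in \<open>auto simp: composition_def\<close>)
qed

text \<open>Compare the first part \<open>i\<close> of \<open>J\<close> with the first part
  \<open>c\<close> of \<open>I\<close>. If \<open>i \<le> c\<close>, the first segment is increasing
  and the rest is handled by induction; if \<open>i > c\<close>, a segment of that length would
  contain a descent, and \<open>J\<close> cannot refine \<open>I\<close>.\<close>

lemma seg_prod_distinct:
  assumes "distinct w" "is_descent_composition w I" "composition J"
  shows "seg_prod J w = (if refines J I then 1 else 0)"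
  using assms
proof (induction J arbitrary: w I)
  case Nil
  then have "I = [] \<longleftrightarrow> w = []"
    by (cases I) (auto simp: is_descent_composition_def composition_def)
  then show ?case by (simp add: refines_Nil_left)
next
  case (Cons i J)
  then have i: "i \<ge> 1" "composition J" by (auto simp: composition_def)
  have I: "composition I" "sum_list I = length w"
    using Cons.prems(2) by (auto simp: is_descent_composition_def)
  show ?case
  proof (cases I)
    case Nil
    \<comment> \<open>Here \<open>w\<close> is empty while \<open>J\<close> starts with a positive
      part, so both sides are 0.\<close>
    then show ?thesis using I i by (simp add: seg_prod_Cons refines_Nil_right del: seg_prod.simps(2))
  next
    case I_Cons: (Cons c I')
    note D = is_descent_composition_Cons[OF Cons.prems(2)[unfolded I_Cons]]
    have c: "c \<le> length w" "c \<ge> 1" using I I_Cons by (auto simp: composition_def)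
    note ref = refines_Cons_Cons[OF Cons.prems(3)]
    have ascending: "zeta (take i w) = 1" if "i \<le> c"
    proof -
      have "sorted (take i w)"
        using D(1)[of "Suc _"] that c by (auto simp: sorted_iff_nth_Suc)
      then show ?thesis using Cons.prems(1) by (simp add: zeta_distinct)
    qed
    consider "i < c" | "i = c" | "i > c" by linarith
    then show ?thesis
    proof cases
      case 1
      then show ?thesis
        using Cons.IH[of "drop i w" "(c - i) # I'"] D(4) ascending c i(2) Cons.prems(1)
        by (simp add: seg_prod_Cons I_Cons ref del: seg_prod.simps(2))
    next
      case 2
      then show ?thesis
        unfolding I_Cons ref using Cons.IH[of "drop i w" I'] D(3) ascending c i(2) Cons.prems(1)
        by (simp add: seg_prod_Cons del: seg_prod.simps(2))
    next
      case 3
      have "zeta (take i w) = 0" if "i \<le> length w"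
      proof -
        have "\<not> sorted (take i w)"
        proof
          assume "sorted (take i w)"
          \<comment> \<open>Since \<open>c < i\<close>, both letters of the descent at
            \<open>c\<close> lie in the segment.\<close>
          then have "take i w ! (c - 1) \<le> take i w ! c"
            using 3 that by (intro sorted_nth_mono) auto
          then show False using D(2) 3 that by simp
        qed
        then show ?thesis using Cons.prems(1) by (simp add: zeta_distinct)
      qed
      then show ?thesis
        using 3 by (simp add: seg_prod_Cons I_Cons ref del: seg_prod.simps(2))
    qed
  qed
qed

lemma theta_word_distinct:
  assumes "distinct w"
  shows "theta_word w = F_qsym (Des w)"
proof
  fix m
  have "F_qsym (Des w) m = (\<Sum>J | composition J \<and> refines J (Des w). if J = exponents m then 1 else 0)"
    unfolding F_qsym_def sum_fun_apply by (intro sum.cong) (auto simp: M_qsym_eq)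
  also have "\<dots> = seg_prod (exponents m) w"
    unfolding seg_prod_distinct[OF assms is_descent_composition_Des composition_exponents]
    by (simp add: finite_refinements composition_exponents)
  finally show "theta_word w m = F_qsym (Des w) m" by (simp add: theta_word_def)
qed

section \<open>Extension from words to a morphism of Hopf algebras\<close>

theorem theorem6p2p1:
  shows "\<exists>\<theta> :: (nat list \<Rightarrow> real) \<Rightarrow> power_series.
           hopf_morphism shuffle_hopf qsym_hopf \<theta> \<and>
           (\<forall>w. is_word w \<and> distinct w \<longrightarrow> \<theta> (word w) = F_qsym (Des w))"
proof (intro exI conjI allI impI)
  let ?\<theta> = "lin_ext theta_word"
  \<comment> \<open>The witness for \<theta> \<otimes> \<theta>; its kernel is the product kernel of
    \<open>lin_ext_tensor\<close>.\<close>
  let ?\<Theta> = "lin_ext (\<lambda>(u, v) (m, n). theta_word u m * theta_word v n)"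
  let ?B = "{word w | w. is_word w}"
  let ?T = "tensor_space (span ?B) (span ?B)"
  let ?A = "hspace shuffle_hopf"
  have A: "?A = span ?B" by (simp add: shuffle_hopf_def)
  have lin: "linear_on (span ?B) ?\<theta>"
    by (rule linear_on_subset[OF linear_on_lin_ext]) (auto intro: finite_support_word)
  have Lin: "linear_on ?T ?\<Theta>"
    by (rule linear_on_subset[OF linear_on_lin_ext]) (auto intro: finite_support_tensor_space)
  have word_qsym: "theta_word w \<in> qsym" for w
    using theta_word_in_span[of w] unfolding qsym_def by (rule subsetD[OF span_mono, rotated]) auto
  have closed: "?\<theta> f \<in> qsym" if "f \<in> span ?B" for f
    unfolding qsym_def using lin that
    by (rule linear_on_span_image) (use word_qsym in \<open>auto simp: lin_ext_word qsym_def\<close>)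
  have degree: "?\<theta> f \<in> span {M_qsym I | I. composition I \<and> sum_list I = n}"
    if "f \<in> span {word w | w. is_word w \<and> length w = n}" for f n
  proof (rule linear_on_span_image[OF _ that])
    show "linear_on (span {word w |w. is_word w \<and> length w = n}) ?\<theta>"
      by (rule linear_on_subset[OF linear_on_lin_ext]) (auto intro: finite_support_word)
  qed (use theta_word_in_span in \<open>auto simp: lin_ext_word\<close>)
  have words_mult: "shuffle_mult (word u) (word v) \<in> span ?B" if "is_word u" "is_word v" for u v
  proof -
    have "is_word w" if "w \<in> set (interleavings u v)" for w
      using mset_interleavings[OF that] \<open>is_word u\<close> \<open>is_word v\<close> unfolding is_word_def
      by (metis Un_iff set_mset_mset set_mset_union)
    then have "\<forall>w\<in>set ws. is_word w \<Longrightarrow> (\<Sum>w\<leftarrow>ws. word w) \<in> span ?B" for ws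
      by (induction ws) (auto intro: span_add span_base span_zero)
    then show ?thesis
      unfolding shuffle_mult_word using \<open>\<And>w. w \<in> set (interleavings u v) \<Longrightarrow> is_word w\<close> by blast
  qed
  have lin_mult: "linear_on V (\<lambda>f. shuffle_mult f g)" "linear_on V (shuffle_mult g)" for V g
    by (auto simp: linear_on_def shuffle_mult_def scaleR_fun_def fun_eq_iff algebra_simps
        sum.distrib sum_distrib_left)
  have lin_ps: "linear_on V (\<lambda>f. ps_mult f g)" "linear_on V (ps_mult g)" for V g
    by (auto simp: linear_on_def ps_mult_def scaleR_fun_def fun_eq_iff algebra_simps
        sum.distrib sum_distrib_left case_prod_unfold)
  \<comment> \<open>Bilinear facts are extended from words to the span in two passes, first in the
    right and then in the left argument.\<close>
  have word_mult_closed: "shuffle_mult (word u) g \<in> span ?B" if "is_word u" "g \<in> span ?B" for u g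
    using lin_mult(2) that(2) by (rule linear_on_span_image) (use that words_mult in auto)
  have mult_closed: "shuffle_mult f g \<in> span ?B" if "f \<in> span ?B" "g \<in> span ?B" for f g
    using lin_mult(1) that(1) by (rule linear_on_span_image) (use that word_mult_closed in auto)
  have mult_words: "?\<theta> (shuffle_mult (word u) (word v)) = ps_mult (theta_word u) (theta_word v)"
    if "is_word u" "is_word v" for u v
  proof
    fix m
    have fin: "linear_on {f. finite {x. f x \<noteq> 0}} ?\<theta>" by (rule linear_on_lin_ext)
    \<comment> \<open>Finite support is part of the induction because additivity of
      \<open>lin_ext\<close> depends on it.\<close>
    have "finite {x. (\<Sum>w\<leftarrow>ws. word w) x \<noteq> 0} \<and> ?\<theta> (\<Sum>w\<leftarrow>ws. word w) = (\<Sum>w\<leftarrow>ws. theta_word w)" for ws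
    proof (induction ws)
      case Nil
      show ?case by (simp add: lin_ext_def fun_eq_iff)
    next
      case (Cons w ws)
      have w: "finite {x. word w x \<noteq> 0}" by (simp add: word_def)
      have "{x. (word w + (\<Sum>w\<leftarrow>ws. word w)) x \<noteq> 0} \<subseteq>
          {x. word w x \<noteq> 0} \<union> {x. (\<Sum>w\<leftarrow>ws. word w) x \<noteq> 0}" by auto
      then have "finite {x. (word w + (\<Sum>w\<leftarrow>ws. word w)) x \<noteq> 0}"
        using w Cons.IH by (meson finite_UnI finite_subset)
      moreover have "?\<theta> (word w + (\<Sum>w\<leftarrow>ws. word w)) = ?\<theta> (word w) + ?\<theta> (\<Sum>w\<leftarrow>ws. word w)"
        by (rule linear_onD(1)[OF fin]) (use w Cons.IH in auto)
      ultimately show ?case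
        using Cons.IH by (simp only: list.map sum_list.Cons lin_ext_word)
    qed
    then have "?\<theta> (shuffle_mult (word u) (word v)) m = shuffle_sum u v (\<lambda>w. theta_word w m)"
      by (simp add: shuffle_mult_word sum_list_fun_apply)
    also have "\<dots> = ps_mult (theta_word u) (theta_word v) m"
      using ps_mult_seg_prod[of u v m] by (simp add: theta_word_def)
    finally show "?\<theta> (shuffle_mult (word u) (word v)) m = ps_mult (theta_word u) (theta_word v) m" .
  qed
  have mult_word: "?\<theta> (shuffle_mult (word u) g) = ps_mult (theta_word u) (?\<theta> g)"
    if "is_word u" "g \<in> span ?B" for u g
  proof (rule linear_on_span_eqI[OF _ _ that(2)])
    show "linear_on (span ?B) (\<lambda>g. ?\<theta> (shuffle_mult (word u) g))"
      by (rule linear_on_compose[OF lin_mult(2) lin]) (use that word_mult_closed in auto)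
    show "linear_on (span ?B) (\<lambda>g. ps_mult (theta_word u) (?\<theta> g))"
      by (rule linear_on_compose[OF lin lin_ps(2)[of UNIV]]) auto
  qed (use that mult_words in \<open>auto simp: lin_ext_word\<close>)
  have mult: "?\<theta> (shuffle_mult f g) = ps_mult (?\<theta> f) (?\<theta> g)"
    if "f \<in> span ?B" "g \<in> span ?B" for f g
  proof (rule linear_on_span_eqI[OF _ _ that(1)])
    show "linear_on (span ?B) (\<lambda>f. ?\<theta> (shuffle_mult f g))"
      by (rule linear_on_compose[OF lin_mult(1) lin]) (use that mult_closed in auto)
    show "linear_on (span ?B) (\<lambda>f. ps_mult (?\<theta> f) (?\<theta> g))"
      by (rule linear_on_compose[OF lin lin_ps(1)[of UNIV]]) auto
  qed (use that mult_word in \<open>auto simp: lin_ext_word\<close>)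
  have tensor: "?\<Theta> (tensor f g) = tensor (?\<theta> f) (?\<theta> g)" if "f \<in> span ?B" "g \<in> span ?B" for f g
    by (rule lin_ext_tensor) (use that finite_support_word in auto)
  have comult_closed: "shuffle_comult ` span ?B \<subseteq> ?T"
    using shuffle_comult_in_tensor_space by (auto simp: shuffle_hopf_def)
  have comult_word: "qsym_comult (theta_word w) = ?\<Theta> (shuffle_comult (word w))" if "is_word w" for w
  proof
    fix p :: "monomial \<times> monomial"
    obtain m n where p: "p = (m, n)" by force
    let ?f = "\<lambda>i. (take i w, drop i w)"
    have inj: "inj_on ?f {..length w}"
      by (rule inj_onI) (metis Pair_inject atMost_iff length_take min.absorb2)
    \<comment> \<open>The deconcatenation of \<open>w\<close> is supported on its splittings, which
      are indexed injectively by the prefix length.\<close>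
    have "?\<Theta> (shuffle_comult (word w)) p =
        (\<Sum>(u, v)\<in>?f ` {..length w}. shuffle_comult (word w) (u, v) * (theta_word u m * theta_word v n))"
      unfolding p
    proof (subst lin_ext_superset[of "?f ` {..length w}"])
      show "{x. shuffle_comult (word w) x \<noteq> 0} \<subseteq> ?f ` {..length w}"
      proof clarify
        fix u v assume "shuffle_comult (word w) (u, v) \<noteq> 0"
        then have "w = u @ v" by (auto simp: shuffle_comult_def word_def split: if_splits)
        then show "(u, v) \<in> ?f ` {..length w}" by (intro image_eqI[of _ _ "length u"]) auto
      qed
    qed (auto intro!: sum.cong)
    also have "\<dots> = (\<Sum>i\<le>length w. theta_word (take i w) m * theta_word (drop i w) n)"
      by (simp add: sum.reindex[OF inj] shuffle_comult_def word_def)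
    also have "\<dots> = qsym_comult (theta_word w) p"
      unfolding p qsym_comult_theta_word by (simp add: conv_def theta_word_def)
    finally show "qsym_comult (theta_word w) p = ?\<Theta> (shuffle_comult (word w)) p" ..
  qed
  have comult: "qsym_comult (?\<theta> f) = ?\<Theta> (shuffle_comult f)" if "f \<in> span ?B" for f
  proof (rule linear_on_span_eqI[OF _ _ that])
    show "linear_on (span ?B) (\<lambda>f. qsym_comult (?\<theta> f))"
      by (rule linear_on_compose[OF lin linear_on_qsym_comult]) (use closed in auto)
    show "linear_on (span ?B) (\<lambda>f. ?\<Theta> (shuffle_comult f))"
      by (rule linear_on_compose[OF _ Lin comult_closed])
        (auto simp: linear_on_def shuffle_comult_def scaleR_fun_def fun_eq_iff)
  qed (use comult_word in \<open>auto simp: lin_ext_word\<close>)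
  show "hopf_morphism shuffle_hopf qsym_hopf ?\<theta>"
    unfolding hopf_morphism_def shuffle_hopf_def qsym_hopf_def graded_hopf.simps
    using closed lin degree mult Lin tensor comult
    by (intro conjI exI[of _ ?\<Theta>]) (auto simp: lin_ext_word theta_word_Nil)
  show "?\<theta> (word w) = F_qsym (Des w)" if "is_word w \<and> distinct w" for w
    using that by (simp add: lin_ext_word theta_word_distinct)
qed

end
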